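(* Let $\mathfrak{H}_*$ be a complex Hilbert space, let $O$ be a bounded self-adjoint operator on $\mathfrak{H}_*$ with purely discrete spectrum, and let $H_*\in\mathscr{P}_{\mathfrak{H}_*}(O)$. Then for every $H\in\mathscr{P}_{\mathfrak{H}_*}(O)$ belonging to the $H_*$-stability class $\mathscr{U}_O(H_* )$, one has $\mu(H)=\mu(H_* )$.
   Context: Cones. In a complex Hilbert space $\mathfrak{H}$, a convex cone is a closed convex set $\mathfrak{P}\subset\mathfrak{H}$ with $t\mathfrak{P}\subseteq\mathfrak{P}$ for all $t\ge0$ and $\mathfrak{P}\cap(-\mathfrak{P})=\{0\}$. It is self-dual if $\mathfrak{P}=\{\eta\in\mathfrak{H}: \langle\eta|\xi\rangle\ge0\ \forall\xi\in\mathfrak{P}\}$. A vector $\eta\in\mathfrak{P}$ is strictly positive ($\eta>0$ w.r.t. $\mathfrak{P}$) if $\langle\xi|\eta\rangle>0$ for all $\xi\in\mathfrak{P}\setminus\{0\}$. For bounded $A$: $A\unrhd0$ w.r.t. $\mathfrak{P}$ means $A\mathfrak{P}\subseteq\mathfrak{P}$; $A\rhd0$ w.r.t. $\mathfrak{P}$ means $A\xi>0$ w.r.t. $\mathfrak{P}$ for all $\xi\in\mathfrak{P}\setminus\{0\}$. For a self-dual cone $\mathfrak{P}$ in $\mathfrak{H}$, $\mathscr{A}^+_{\mathfrak{P}}$ is the set of self-adjoint operators $H$ on $\mathfrak{H}$ that are bounded from below, have purely discrete spectrum (empty essential spectrum), and satisfy $(H+s)^{-1}\rhd0$ w.r.t.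 $\mathfrak{P}$ for all $s>-E(H)$, where $E(H)=\inf\mathrm{spec}(H)$. If $H\in\mathscr{A}^+_{\mathfrak{P}}$ then $E(H)$ is a simple eigenvalue with a strictly positive eigenvector, denoted $\psi_H$. Inheritance. Let $\mathfrak{H}_1$ be a closed subspace of $\mathfrak{H}_2$, $\pi_{1,2}$ the orthogonal projection of $\mathfrak{H}_2$ onto $\mathfrak{H}_1$, and $\mathfrak{P}_j\subset\mathfrak{H}_j$ self-dual cones. Write $\mathfrak{P}_1\dashrightarrow\mathfrak{P}_2$ if $\mathfrak{P}_1=\pi_{1,2}\mathfrak{P}_2$ and $\pi_{1,2}\unrhd0$ w.r.t. $\mathfrak{P}_2$. For $H_j\in\mathscr{A}^+_{\mathfrak{P}_j}$ write $(H_1,\mathfrak{P}_1)\to(H_2,\mathfrak{P}_2)$ if $\mathfrak{P}_1\dashrightarrow\mathfrak{P}_2$. The class. $\mathbb{H}_{\mathfrak{H}_*}$ is the collection of all Hilbert spaces containing $\mathfrak{H}_*$ as a closed subspace. $O$ is extended to each $\mathfrak{H}\in\mathbb{H}_{\mathfrak{H}_*}$ as $O\oplus0$ on $\mathfrak{H}_*\oplus\mathfrak{H}_*^\perp$, again denoted $O$. $\mathscr{P}_{\mathfrak{H}_*,0}=\bigcup_{\mathfrak{H}\in\mathbb{H}_{\mathfrak{H}_*}}\bigcup_{\mathfrak{P}\subset\mathfrak{H}\text{ self-dual cone}}\mathscr{A}^+_{\mathfrak{P}}$, and $\mathscr{P}_{\mathfrak{H}_*,0}(O)$ is the set of $H\in\mathscr{P}_{\mathfrak{H}_*,0}$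 with $e^{isO}e^{itH}=e^{itH}e^{isO}$ for all $s,t\in\mathbb{R}$. The order. For $H,K\in\mathscr{P}_{\mathfrak{H}_*,0}(O)$, write $H\to K$ if there are $N\ge2$, Hilbert spaces $\mathfrak{H}_1\subseteq\dots\subseteq\mathfrak{H}_N$ in $\mathbb{H}_{\mathfrak{H}_*}$ (each a closed subspace of the next), operators $H_j\in\mathscr{P}_{\mathfrak{H}_*,0}(O)$ acting in $\mathfrak{H}_j$ with $H_1=H$, $H_N=K$, and self-dual cones $\mathfrak{P}_j\subset\mathfrak{H}_j$ ($1\le j\le N-1$), $\mathfrak{P}_j'\subset\mathfrak{H}_j$ ($2\le j\le N$) such that $(H_j,\mathfrak{P}_j)\to(H_{j+1},\mathfrak{P}_{j+1}')$ for $j=1,\dots,N-1$. This is a preorder; $H\equiv K$ means $H\to K$ and $K\to H$; $\mathscr{P}_{\mathfrak{H}_*}(O)=\mathscr{P}_{\mathfrak{H}_*,0}(O)/\equiv$ with the induced partial order $\to$, and a class $[H]$ is identified with its representative $H$. Stability class: $\mathscr{U}_O(H_* )=\{H\in\mathscr{P}_{\mathfrak{H}_*}(O): H_*\to H\}$. Good quantum number: since $E(H)$ is simple and $H$ commutes strongly with $O$, $\psi_H$ is an eigenvector of $O$, and $\mu(H)$ is defined by $O\psi_H=\mu(H)\psi_H$. *)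

theory Defs
  imports "HOL-Analysis.Analysis" "HOL-Library.Complex_Order"
begin

section \<open>Complex Hilbert spaces\<close>

text \<open>
  The inner product is conjugate linear in the first and linear in the second argument. Its real
  part is the real inner product of the class \<^class>\<open>real_inner\<close>, which supplies definiteness,
  the norm and the topology.
\<close>

class complex_hilbert = real_inner + complete_space +
  fixes scaleC :: "complex \<Rightarrow> 'a \<Rightarrow> 'a"  (infixr \<open>*\<^sub>C\<close> 75)
    and cinner :: "'a \<Rightarrow> 'a \<Rightarrow> complex"
  assumes scaleC_add_right: "c *\<^sub>C (x + y) = c *\<^sub>C x + c *\<^sub>C y"
    and scaleC_add_left: "(c + d) *\<^sub>C x = c *\<^sub>C x + d *\<^sub>C x"
    and scaleC_scaleC: "c *\<^sub>C d *\<^sub>C x = (c * d) *\<^sub>C x"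
    and scaleC_complex_of_real: "complex_of_real r *\<^sub>C x = r *\<^sub>R x"
    and cinner_commute: "cinner x y = cnj (cinner y x)"
    and cinner_add_right: "cinner x (y + z) = cinner x y + cinner x z"
    and cinner_scaleC_right: "cinner x (c *\<^sub>C y) = c * cinner x y"
    and Re_cinner: "Re (cinner x y) = inner x y"

global_interpretation complex_vector:
  vector_space "scaleC :: complex \<Rightarrow> 'a \<Rightarrow> 'a::complex_hilbert"
proof
  fix c d :: complex and x y :: 'a
  show "c *\<^sub>C (x + y) = c *\<^sub>C x + c *\<^sub>C y" by (rule scaleC_add_right)
  show "(c + d) *\<^sub>C x = c *\<^sub>C x + d *\<^sub>C x" by (rule scaleC_add_left)
  show "c *\<^sub>C d *\<^sub>C x = (c * d) *\<^sub>C x" by (rule scaleC_scaleC)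
  show "1 *\<^sub>C x = x" using scaleC_complex_of_real[of 1 x] by simp
qed

text \<open>
  Every Hilbert space below is a closed complex subspace \<open>S\<close> of an arbitrary Hilbert space
  \<open>'a\<close>. The relation \<open>H \<rightarrow> K\<close> defined at the end only involves closed subspaces of the space in
  which \<open>K\<close> acts, so it does not depend on the choice of \<open>'a\<close>.
\<close>

definition hilbert_subspace :: "'a::complex_hilbert set \<Rightarrow> bool" where
  "hilbert_subspace S \<longleftrightarrow> complex_vector.subspace S \<and> closed S"

definition hilbert_spaces_over :: "'a::complex_hilbert set \<Rightarrow> 'a set set" where
  "hilbert_spaces_over Sstar = {S. hilbert_subspace S \<and> Sstar \<subseteq> S}"

definition orth_proj :: "'a::complex_hilbert set \<Rightarrow> 'a \<Rightarrow> 'a" where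
  "orth_proj S x = (THE y. y \<in> S \<and> (\<forall>z\<in>S. cinner z (x - y) = 0))"


section \<open>Unbounded operators\<close>

text \<open>
  An operator is a partial function; its domain is \<open>dom H\<close>. Since self-adjoint operators are
  densely defined, the Hilbert space in which such an operator acts is the closure of its domain.
\<close>

type_synonym 'a operator = "'a \<rightharpoonup> 'a"

definition hspace :: "'a::complex_hilbert operator \<Rightarrow> 'a set" where
  "hspace H = closure (dom H)"

definition linear_operator :: "'a::complex_hilbert operator \<Rightarrow> bool" where
  "linear_operator H \<longleftrightarrow>
     complex_vector.subspace (dom H) \<and>
     (\<forall>\<phi>\<in>dom H. \<forall>\<psi>\<in>dom H. the (H (\<phi> + \<psi>)) = the (H \<phi>) + the (H \<psi>)) \<and>
     (\<forall>c. \<forall>\<psi>\<in>dom H. the (H (c *\<^sub>C \<psi>)) = c *\<^sub>C the (H \<psi>))"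

definition adjoint_in :: "'a::complex_hilbert set \<Rightarrow> 'a operator \<Rightarrow> 'a operator" where
  "adjoint_in S H = (\<lambda>\<phi>.
     if \<phi> \<in> S \<and> (\<exists>\<zeta>\<in>S. \<forall>\<psi>\<in>dom H. cinner \<phi> (the (H \<psi>)) = cinner \<zeta> \<psi>)
     then Some (THE \<zeta>. \<zeta> \<in> S \<and> (\<forall>\<psi>\<in>dom H. cinner \<phi> (the (H \<psi>)) = cinner \<zeta> \<psi>))
     else None)"

definition self_adjoint_on :: "'a::complex_hilbert set \<Rightarrow> 'a operator \<Rightarrow> bool" where
  "self_adjoint_on S H \<longleftrightarrow>
     hilbert_subspace S \<and> linear_operator H \<and> closure (dom H) = S \<and> ran H \<subseteq> S \<and>
     adjoint_in S H = H"

definition bounded_operator_on :: "'a::complex_hilbert set \<Rightarrow> 'a operator \<Rightarrow> bool" where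
  "bounded_operator_on S A \<longleftrightarrow>
     linear_operator A \<and> dom A = S \<and> ran A \<subseteq> S \<and> (\<exists>c. \<forall>\<psi>\<in>S. norm (the (A \<psi>)) \<le> c * norm \<psi>)"

definition bounded_from_below :: "'a::complex_hilbert operator \<Rightarrow> bool" where
  "bounded_from_below H \<longleftrightarrow>
     (\<exists>c. \<forall>\<psi>\<in>dom H. complex_of_real (c * (norm \<psi>)\<^sup>2) \<le> cinner \<psi> (the (H \<psi>)))"

definition resolvent_set :: "'a::complex_hilbert operator \<Rightarrow> complex set" where
  "resolvent_set H =
     {z. bij_betw (\<lambda>\<psi>. the (H \<psi>) - z *\<^sub>C \<psi>) (dom H) (hspace H) \<and>
         (\<exists>c. \<forall>\<psi>\<in>dom H. norm \<psi> \<le> c * norm (the (H \<psi>) - z *\<^sub>C \<psi>))}"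

definition spec :: "'a::complex_hilbert operator \<Rightarrow> complex set" where
  "spec H = - resolvent_set H"

definition eigenspace :: "'a::complex_hilbert operator \<Rightarrow> complex \<Rightarrow> 'a set" where
  "eigenspace H z = {\<psi> \<in> dom H. the (H \<psi>) = z *\<^sub>C \<psi>}"

text \<open>The isolated points of the spectrum that are eigenvalues of finite multiplicity.\<close>

definition discrete_spec :: "'a::complex_hilbert operator \<Rightarrow> complex set" where
  "discrete_spec H =
     {z. z isolated_in spec H \<and> eigenspace H z \<noteq> {0} \<and>
         (\<exists>B. finite B \<and> eigenspace H z \<subseteq> complex_vector.span B)}"

definition essential_spec :: "'a::complex_hilbert operator \<Rightarrow> complex set" where
  "essential_spec H = spec H - discrete_spec H"

definition purely_discrete_spec :: "'a::complex_hilbert operator \<Rightarrow> bool" where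
  "purely_discrete_spec H \<longleftrightarrow> essential_spec H = {}"

definition ground_energy :: "'a::complex_hilbert operator \<Rightarrow> real" where
  "ground_energy H = Inf {x. complex_of_real x \<in> spec H}"

text \<open>\<open>shifted_inverse H s\<close> is \<open>(H + s)\<inverse>\<close>; it is only used when \<open>- s\<close> is not in the spectrum.\<close>

definition shifted_inverse :: "'a::complex_hilbert operator \<Rightarrow> real \<Rightarrow> 'a \<Rightarrow> 'a" where
  "shifted_inverse H s \<eta> = (THE \<psi>. \<psi> \<in> dom H \<and> the (H \<psi>) + s *\<^sub>R \<psi> = \<eta>)"


section \<open>Unitary groups and strong commutation\<close>

text \<open>
  \<open>U\<close> is a strongly continuous one-parameter unitary group on \<open>hspace H\<close> with generator \<open>H\<close>:
  \<open>H \<psi>\<close> is defined and equal to \<open>\<phi>\<close> iff \<open>t \<mapsto> U t \<psi>\<close> is differentiable at \<open>0\<close> with derivative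
  \<open>\<i> \<phi>\<close>. The values \<open>U t\<close> outside \<open>hspace H\<close> are fixed by \<^const>\<open>PiE\<close>. By Stone's theorem,
  every self-adjoint \<open>H\<close> has exactly one such group, namely \<open>exp (\<i> t H)\<close>.
\<close>

definition unitary_group_of ::
  "'a::complex_hilbert operator \<Rightarrow> (real \<Rightarrow> 'a \<Rightarrow> 'a) \<Rightarrow> bool" where
  "unitary_group_of H U \<longleftrightarrow>
     (\<forall>t. U t \<in> hspace H \<rightarrow>\<^sub>E hspace H \<and> U t ` hspace H = hspace H) \<and>
     (\<forall>t. \<forall>\<phi>\<in>hspace H. \<forall>\<psi>\<in>hspace H. U t (\<phi> + \<psi>) = U t \<phi> + U t \<psi>) \<and>
     (\<forall>t c. \<forall>\<psi>\<in>hspace H. U t (c *\<^sub>C \<psi>) = c *\<^sub>C U t \<psi>) \<and>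
     (\<forall>t. \<forall>\<phi>\<in>hspace H. \<forall>\<psi>\<in>hspace H. cinner (U t \<phi>) (U t \<psi>) = cinner \<phi> \<psi>) \<and>
     (\<forall>\<psi>\<in>hspace H. U 0 \<psi> = \<psi>) \<and>
     (\<forall>s t. \<forall>\<psi>\<in>hspace H. U (s + t) \<psi> = U s (U t \<psi>)) \<and>
     (\<forall>\<psi>\<in>hspace H. continuous_on UNIV (\<lambda>t. U t \<psi>)) \<and>
     (\<forall>\<psi>\<in>hspace H. \<forall>\<phi>. H \<psi> = Some \<phi> \<longleftrightarrow>
        ((\<lambda>t. U t \<psi>) has_vector_derivative (\<i> *\<^sub>C \<phi>)) (at 0))"

definition exp_i :: "real \<Rightarrow> 'a::complex_hilbert operator \<Rightarrow> 'a \<Rightarrow> 'a" where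
  "exp_i t H = (THE U. unitary_group_of H U) t"

definition strongly_commute ::
  "'a::complex_hilbert operator \<Rightarrow> 'a operator \<Rightarrow> bool" where
  "strongly_commute A H \<longleftrightarrow>
     (\<forall>s t. \<forall>\<psi>\<in>hspace H. exp_i s A (exp_i t H \<psi>) = exp_i t H (exp_i s A \<psi>))"

text \<open>The operator \<open>A \<oplus> 0\<close> on \<open>S\<close>, for a bounded operator \<open>A\<close> on the closed subspace \<open>Sstar\<close> of \<open>S\<close>.\<close>

definition extend_by_zero ::
  "'a::complex_hilbert set \<Rightarrow> 'a operator \<Rightarrow> 'a set \<Rightarrow> 'a operator" where
  "extend_by_zero Sstar A S = (\<lambda>\<psi>. if \<psi> \<in> S then A (orth_proj Sstar \<psi>) else None)"


section \<open>Self-dual cones\<close>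

definition convex_cone_in :: "'a::complex_hilbert set \<Rightarrow> 'a set \<Rightarrow> bool" where
  "convex_cone_in S P \<longleftrightarrow> P \<subseteq> S \<and> closed P \<and> convex P \<and> cone P \<and> P \<inter> uminus ` P = {0}"

definition self_dual_cone :: "'a::complex_hilbert set \<Rightarrow> 'a set \<Rightarrow> bool" where
  "self_dual_cone S P \<longleftrightarrow>
     convex_cone_in S P \<and> P = {\<eta> \<in> S. \<forall>\<xi>\<in>P. 0 \<le> cinner \<eta> \<xi>}"

definition strictly_positive :: "'a::complex_hilbert set \<Rightarrow> 'a \<Rightarrow> bool" where
  "strictly_positive P \<eta> \<longleftrightarrow> \<eta> \<in> P \<and> (\<forall>\<xi>\<in>P - {0}. 0 < cinner \<xi> \<eta>)"

definition positivity_preserving :: "'a::complex_hilbert set \<Rightarrow> ('a \<Rightarrow> 'a) \<Rightarrow> bool" where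
  "positivity_preserving P A \<longleftrightarrow> A ` P \<subseteq> P"

definition positivity_improving :: "'a::complex_hilbert set \<Rightarrow> ('a \<Rightarrow> 'a) \<Rightarrow> bool" where
  "positivity_improving P A \<longleftrightarrow> (\<forall>\<xi>\<in>P - {0}. strictly_positive P (A \<xi>))"


section \<open>The operator classes\<close>

text \<open>
  The zero space is excluded: there the spectrum is empty, and neither \<open>E(H)\<close> nor a ground state
  exists.
\<close>

definition A_plus :: "'a::complex_hilbert set \<Rightarrow> 'a set \<Rightarrow> 'a operator set" where
  "A_plus S P =
     {H. S \<noteq> {0} \<and> self_adjoint_on S H \<and> bounded_from_below H \<and> purely_discrete_spec H \<and>
         (\<forall>s > - ground_energy H. positivity_improving P (shifted_inverse H s))}"

definition P_zero :: "'a::complex_hilbert set \<Rightarrow> 'a operator set" where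
  "P_zero Sstar =
     (\<Union>S\<in>hilbert_spaces_over Sstar. \<Union>P\<in>{P. self_dual_cone S P}. A_plus S P)"

definition P_zero_comm :: "'a::complex_hilbert set \<Rightarrow> 'a operator \<Rightarrow> 'a operator set" where
  "P_zero_comm Sstar A =
     {H \<in> P_zero Sstar. strongly_commute (extend_by_zero Sstar A (hspace H)) H}"


section \<open>Inheritance and the order\<close>

definition cone_inherits ::
  "'a::complex_hilbert set \<Rightarrow> 'a set \<Rightarrow> 'a set \<Rightarrow> 'a set \<Rightarrow> bool" where
  "cone_inherits S\<^sub>1 P\<^sub>1 S\<^sub>2 P\<^sub>2 \<longleftrightarrow>
     hilbert_subspace S\<^sub>1 \<and> hilbert_subspace S\<^sub>2 \<and> S\<^sub>1 \<subseteq> S\<^sub>2 \<and>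
     self_dual_cone S\<^sub>1 P\<^sub>1 \<and> self_dual_cone S\<^sub>2 P\<^sub>2 \<and>
     P\<^sub>1 = orth_proj S\<^sub>1 ` P\<^sub>2 \<and> positivity_preserving P\<^sub>2 (orth_proj S\<^sub>1)"

definition inherits ::
  "'a::complex_hilbert operator \<times> 'a set \<Rightarrow> 'a operator \<times> 'a set \<Rightarrow> bool" where
  "inherits = (\<lambda>(H\<^sub>1, P\<^sub>1) (H\<^sub>2, P\<^sub>2).
     H\<^sub>1 \<in> A_plus (hspace H\<^sub>1) P\<^sub>1 \<and> H\<^sub>2 \<in> A_plus (hspace H\<^sub>2) P\<^sub>2 \<and>
     cone_inherits (hspace H\<^sub>1) P\<^sub>1 (hspace H\<^sub>2) P\<^sub>2)"

definition leads_to ::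
  "'a::complex_hilbert set \<Rightarrow> 'a operator \<Rightarrow> 'a operator \<Rightarrow> 'a operator \<Rightarrow> bool" where
  "leads_to Sstar A H K \<longleftrightarrow>
     H \<in> P_zero_comm Sstar A \<and> K \<in> P_zero_comm Sstar A \<and>
     (\<exists>(N::nat) S Hs P P'.
        N \<ge> 2 \<and>
        (\<forall>j\<in>{1..N}. S j \<in> hilbert_spaces_over Sstar) \<and>
        (\<forall>j\<in>{1..<N}. S j \<subseteq> S (j + 1)) \<and>
        (\<forall>j\<in>{1..N}. Hs j \<in> P_zero_comm Sstar A \<and> hspace (Hs j) = S j) \<and>
        Hs 1 = H \<and> Hs N = K \<and>
        (\<forall>j\<in>{1..N - 1}. self_dual_cone (S j) (P j)) \<and>
        (\<forall>j\<in>{2..N}. self_dual_cone (S j) (P' j)) \<and>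
        (\<forall>j\<in>{1..N - 1}. inherits (Hs j, P j) (Hs (j + 1), P' (j + 1))))"

definition equiv_rel ::
  "'a::complex_hilbert set \<Rightarrow> 'a operator \<Rightarrow> ('a operator \<times> 'a operator) set" where
  "equiv_rel Sstar A = {(H, K). leads_to Sstar A H K \<and> leads_to Sstar A K H}"

definition P_class :: "'a::complex_hilbert set \<Rightarrow> 'a operator \<Rightarrow> 'a operator set set" where
  "P_class Sstar A = P_zero_comm Sstar A // equiv_rel Sstar A"

text \<open>The order induced on equivalence classes.\<close>

definition class_leads_to ::
  "'a::complex_hilbert set \<Rightarrow> 'a operator \<Rightarrow> 'a operator set \<Rightarrow> 'a operator set \<Rightarrow> bool" where
  "class_leads_to Sstar A C D \<longleftrightarrow> (\<exists>H\<in>C. \<exists>K\<in>D. leads_to Sstar A H K)"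

definition stability_class ::
  "'a::complex_hilbert set \<Rightarrow> 'a operator \<Rightarrow> 'a operator set \<Rightarrow> 'a operator set set" where
  "stability_class Sstar A Cstar = {C \<in> P_class Sstar A. class_leads_to Sstar A Cstar C}"


section \<open>The good quantum number\<close>

text \<open>
  The cone is not part of \<open>H\<close>, but since \<open>E(H)\<close> is a simple eigenvalue, its eigenvector is
  determined up to a scalar, and the eigenvalue below does not depend on the choice.
\<close>

definition ground_state :: "'a::complex_hilbert operator \<Rightarrow> 'a" where
  "ground_state H =
     (SOME \<psi>. \<psi> \<noteq> 0 \<and> \<psi> \<in> eigenspace H (complex_of_real (ground_energy H)) \<and>
        (\<exists>P. self_dual_cone (hspace H) P \<and> H \<in> A_plus (hspace H) P \<and> strictly_positive P \<psi>))"

definition quantum_number ::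
  "'a::complex_hilbert set \<Rightarrow> 'a operator \<Rightarrow> 'a operator \<Rightarrow> complex" where
  "quantum_number Sstar A H =
     (THE m. the (extend_by_zero Sstar A (hspace H) (ground_state H)) = m *\<^sub>C ground_state H)"

end

theory Submission
  imports Defs
begin

text \<open>
  The eigenvalue \<open>\<mu>\<close> cannot change along \<open>\<rightarrow>\<close> because ground states overlap. The ground states \<open>\<phi>\<close>
  of \<open>(H, P)\<close> and \<open>\<psi>\<close> of \<open>(K, Q)\<close> can be chosen strictly positive in their cones. If \<open>(H, P)\<close>
  is inherited by \<open>(K, Q)\<close>, then \<open>P\<close> is the image of \<open>Q\<close> under a projection that preserves \<open>Q\<close>,
  so \<open>\<phi> \<in> P \<subseteq> Q\<close> and \<open>\<langle>\<phi>|\<psi>\<rangle> > 0\<close>. Both vectors are eigenvectors of the observable \<open>O\<close>, which is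
  symmetric and acts on both spaces by the formula \<open>O \<circ> \<pi>\<close>, where \<open>\<pi>\<close> is the projection onto the
  smallest space. Eigenvectors of a symmetric operator that are not orthogonal have the same eigenvalue
  (\<open>quantum_number_inherited\<close>). The theorem follows by induction along a chain that witnesses
  \<open>\<rightarrow>\<close>, and constancy on the equivalence classes is an instance of it.

  What takes work is that \<open>\<mu>\<close> is the eigenvalue it is meant to be. Three results are needed.

  First, \<open>E(H)\<close> is the infimum of the quadratic form of \<open>H\<close> and belongs to the spectrum
  (\<open>ground_energy_attained\<close>), so that discreteness of the spectrum makes it an eigenvalue.

  Secondly, by a Perron-Frobenius argument this eigenvalue is simple with a strictly positive
  eigenvector (\<open>strictly_positive_ground_state\<close>). A self-dual cone \<open>P\<close> makes the Hilbert space the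
  complexification of the real space \<open>P - P\<close>, in which every vector has orthogonal positive and
  negative parts. Replacing \<open>p - q\<close> by \<open>p + q\<close> would strictly increase the form of the resolvent if
  \<open>p\<close> and \<open>q\<close> were both nonzero, which is impossible for an eigenvector at the top of that form.

  Thirdly, strong commutation refers to \<open>exp (\<i> t H)\<close>, and it says something only once this group is
  known to exist and to be unique. This is Stone's theorem (\<open>stone\<close>), proved for operators bounded
  from below by Yosida approximation. Given the groups, \<open>exp (\<i> s O)\<close> maps the ground state into the
  one-dimensional eigenspace, and differentiating at \<open>s = 0\<close> shows that \<open>O\<close> does so too
  (\<open>eigenvector_of_obs\<close>).
\<close>

section \<open>Complex inner products\<close>

instance complex_hilbert \<subseteq> banach ..

lemma cinner_add_left: "cinner (x + y) z = cinner x z + cinner y z"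
  for x :: "'a::complex_hilbert"
  by (metis cinner_commute cinner_add_right complex_cnj_add)

lemma cinner_scaleC_left: "cinner (c *\<^sub>C x) y = cnj c * cinner x y"
  for x :: "'a::complex_hilbert"
  by (metis cinner_commute cinner_scaleC_right complex_cnj_mult)

lemma scaleC_minus1: "(-1) *\<^sub>C x = - x"
  for x :: "'a::complex_hilbert"
  using complex_vector.scale_minus_left[of 1 x] by simp

lemma cinner_minus_right: "cinner x (- y) = - cinner x y"
  for x :: "'a::complex_hilbert"
  using cinner_scaleC_right[of x "-1" y] by (simp add: scaleC_minus1)

lemma cinner_minus_left: "cinner (- x) y = - cinner x y"
  for x :: "'a::complex_hilbert"
  by (metis cinner_commute cinner_minus_right complex_cnj_minus)

lemma cinner_diff_right: "cinner x (y - z) = cinner x y - cinner x z"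
  for x :: "'a::complex_hilbert"
  using cinner_add_right[of x y "- z"] by (simp add: cinner_minus_right)

lemma cinner_diff_left: "cinner (x - y) z = cinner x z - cinner y z"
  for x :: "'a::complex_hilbert"
  using cinner_add_left[of x "- y" z] by (simp add: cinner_minus_left)

lemma cinner_zero_right [simp]: "cinner x 0 = 0"
  for x :: "'a::complex_hilbert"
  using cinner_diff_right[of x 0 0] by simp

lemma cinner_zero_left [simp]: "cinner 0 x = 0"
  for x :: "'a::complex_hilbert"
  using cinner_diff_left[of 0 0 x] by simp

lemma cinner_scaleR_right: "cinner x (r *\<^sub>R y) = of_real r * cinner x y"
  for x :: "'a::complex_hilbert"
  by (metis cinner_scaleC_right scaleC_complex_of_real)

lemma cinner_scaleR_left: "cinner (r *\<^sub>R x) y = of_real r * cinner x y"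
  for x :: "'a::complex_hilbert"
  by (metis cinner_scaleC_left scaleC_complex_of_real complex_cnj_complex_of_real)

lemma scaleC_scaleR: "c *\<^sub>C (r *\<^sub>R x) = r *\<^sub>R (c *\<^sub>C x)"
  for x :: "'a::complex_hilbert"
  by (metis scaleC_complex_of_real scaleC_scaleC mult.commute)

lemma Im_cinner: "Im (cinner x y) = - inner x (\<i> *\<^sub>C y)"
  for x :: "'a::complex_hilbert"
  by (simp add: cinner_scaleC_right flip: Re_cinner)

lemma cinner_self: "cinner x x = of_real ((norm x)\<^sup>2)"
  for x :: "'a::complex_hilbert"
proof -
  have "Im (cinner x x) = 0"
    using arg_cong[OF cinner_commute[of x x], of Im] by simp
  then show ?thesis
    by (simp add: complex_eq_iff Re_cinner power2_norm_eq_inner)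
qed

lemma cinner_self_eq_0: "cinner x x = 0 \<longleftrightarrow> x = 0"
  for x :: "'a::complex_hilbert"
  by (simp add: cinner_self)

lemma norm_scaleC: "norm (c *\<^sub>C x) = cmod c * norm x"
  for x :: "'a::complex_hilbert"
proof -
  have "complex_of_real ((norm (c *\<^sub>C x))\<^sup>2) = of_real ((cmod c * norm x)\<^sup>2)"
    unfolding cinner_self[symmetric] cinner_scaleC_left cinner_scaleC_right
    by (simp add: cinner_self power_mult_distrib complex_norm_square[of c, symmetric])
  then show ?thesis
    by (metis mult_nonneg_nonneg norm_ge_zero of_real_eq_iff power2_eq_iff_nonneg)
qed

lemma bounded_linear_scaleC: "bounded_linear (\<lambda>x::'a::complex_hilbert. c *\<^sub>C x)"
  by (rule bounded_linear_intro[where K = "cmod c"])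
    (auto simp: scaleC_add_right scaleC_scaleR norm_scaleC)

lemma norm_cinner_le: "cmod (cinner x y) \<le> norm x * norm y"
  for x :: "'a::complex_hilbert"
proof -
  define z where "z = cinner x y"
  (* The phase c turns the complex inner product into a nonnegative real number, which reduces the claim
     to the real Cauchy-Schwarz inequality. For z = 0 the default value of division gives c = 0. *)
  define c where "c = cnj z / of_real (cmod z)"
  have "cmod z \<le> inner x (c *\<^sub>C y)"
  proof -
    have "c * z = of_real (cmod z)"
      using complex_norm_square[of z]
      by (cases "z = 0") (simp_all add: c_def power2_eq_square field_simps)
    then show ?thesis
      by (metis Re_cinner Re_complex_of_real cinner_scaleC_right order_refl z_def)
  qed
  also have "\<dots> \<le> norm x * norm (c *\<^sub>C y)"
    by (rule norm_cauchy_schwarz)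
  also have "\<dots> \<le> norm x * norm y"
  proof -
    have "cmod c \<le> 1"
      by (simp add: c_def norm_divide)
    then show ?thesis
      by (simp add: norm_scaleC mult_left_le_one_le mult_left_mono)
  qed
  finally show ?thesis
    by (simp add: z_def)
qed

lemma bounded_linear_cinner_right: "bounded_linear (\<lambda>y::'a::complex_hilbert. cinner x y)"
  by (rule bounded_linear_intro[where K = "norm x"])
    (auto simp: cinner_add_right cinner_scaleR_right scaleR_conv_of_real norm_cinner_le mult.commute
      simp del: mult.commute, metis norm_cinner_le mult.commute)

lemma bounded_linear_cinner_left: "bounded_linear (\<lambda>x::'a::complex_hilbert. cinner x y)"
  by (rule bounded_linear_intro[where K = "norm y"])
    (auto simp: cinner_add_left cinner_scaleR_left scaleR_conv_of_real norm_cinner_le)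

lemmas tendsto_scaleC = bounded_linear.tendsto[OF bounded_linear_scaleC]
lemmas tendsto_cinner_right = bounded_linear.tendsto[OF bounded_linear_cinner_right]
lemmas tendsto_cinner_left = bounded_linear.tendsto[OF bounded_linear_cinner_left]

lemma csubspace_imp_subspace:
  fixes S :: "'a::complex_hilbert set"
  assumes "complex_vector.subspace S"
  shows "subspace S"
  using assms unfolding subspace_def complex_vector.subspace_def
  by (metis scaleC_complex_of_real)

section \<open>Orthogonal projections\<close>

text \<open>
  A sequence that minimizes the distance to \<open>x\<close> is Cauchy: midpoints stay in \<open>C\<close>, so the parallelogram
  law bounds the distance of two almost closest points. The limit is a closest point, and moving from it
  towards another point of \<open>C\<close> cannot decrease the distance to \<open>x\<close>; this is the variational inequality.
  Completeness takes the place of compactness, so the dimension may be infinite.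
\<close>

lemma closest_point_in_closed_convex:
  fixes C :: "'a::{real_inner, complete_space} set"
  assumes "closed C" "convex C" "C \<noteq> {}"
  obtains y where "y \<in> C" "\<And>z. z \<in> C \<Longrightarrow> inner (x - y) (z - y) \<le> 0"
proof -
  define d where "d = infdist x C"
  have d: "d \<le> norm (x - z)" if "z \<in> C" for z
    unfolding d_def using infdist_le[OF that, of x] by (simp add: dist_norm)
  have "\<exists>z\<in>C. norm (x - z) < d + 1 / Suc n" for n
  proof (rule ccontr)
    assume "\<not> ?thesis"
    then have "d + 1 / Suc n \<le> infdist x C"
      unfolding infdist_notempty[OF assms(3)]
      by (intro cINF_greatest[OF assms(3)]) (auto simp: dist_norm not_less)
    then show False
      by (simp add: d_def)
  qed
  then obtain u where u: "\<And>n. u n \<in> C" "\<And>n. norm (x - u n) < d + 1 / Suc n"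
    by metis
  have d0: "0 \<le> d"
    by (simp add: d_def infdist_nonneg)
  have key: "(norm (u m - u n))\<^sup>2 \<le> (8 * d + 4) / Suc N" if "m \<ge> N" "n \<ge> N" for m n N
  proof -
    have mid: "(1/2) *\<^sub>R u m + (1/2) *\<^sub>R u n \<in> C"
      by (rule convexD[OF assms(2) u(1) u(1)]) auto
    have par: "(norm (u m - u n))\<^sup>2 = 2 * (norm (x - u m))\<^sup>2 + 2 * (norm (x - u n))\<^sup>2
       - 4 * (norm (x - ((1/2) *\<^sub>R u m + (1/2) *\<^sub>R u n)))\<^sup>2"
      unfolding power2_norm_eq_inner
      by (simp add: inner_diff_left inner_diff_right inner_add_left inner_add_right
          inner_commute algebra_simps)
    have e: "(norm (x - u k))\<^sup>2 \<le> d\<^sup>2 + (2 * d + 1) / Suc N" if "k \<ge> N" for k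
    proof -
      have "1 / real (Suc k) \<le> 1 / Suc N"
        using that by (intro divide_left_mono) auto
      then have "norm (x - u k) \<le> d + 1 / Suc N"
        using u(2)[of k] by linarith
      then have "(norm (x - u k))\<^sup>2 \<le> (d + 1 / Suc N)\<^sup>2"
        by (intro power_mono) auto
      also have "\<dots> = d\<^sup>2 + 2 * d * (1 / Suc N) + (1 / Suc N) * (1 / Suc N)"
        by (simp add: power2_eq_square algebra_simps)
      also have "\<dots> \<le> d\<^sup>2 + 2 * d * (1 / Suc N) + (1 / Suc N) * 1"
        by (intro add_left_mono mult_left_mono) auto
      finally show ?thesis
        by (simp add: add_divide_distrib)
    qed
    have "d\<^sup>2 \<le> (norm (x - ((1/2) *\<^sub>R u m + (1/2) *\<^sub>R u n)))\<^sup>2"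
      using d[OF mid] d0 by (intro power_mono) auto
    then have "(norm (u m - u n))\<^sup>2 \<le> 4 * ((2 * d + 1) / Suc N)"
      using par e[OF that(1)] e[OF that(2)] by linarith
    then show ?thesis
      by (simp add: algebra_simps)
  qed
  have "Cauchy u"
  proof (rule CauchyI)
    fix e :: real
    assume "0 < e"
    have "(\<lambda>N. (8 * d + 4) / Suc N) \<longlonglongrightarrow> 0"
      using tendsto_mult_right_zero[OF LIMSEQ_inverse_real_of_nat, of "8 * d + 4"]
      by (simp add: field_simps)
    then have "\<forall>\<^sub>F N in sequentially. (8 * d + 4) / Suc N < e\<^sup>2"
      by (rule order_tendstoD) (use \<open>0 < e\<close> in auto)
    then obtain N where N: "(8 * d + 4) / Suc N < e\<^sup>2"
      by (meson eventually_sequentially order_refl)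
    show "\<exists>M. \<forall>m\<ge>M. \<forall>n\<ge>M. norm (u m - u n) < e"
    proof (intro exI allI impI)
      fix m n
      assume "m \<ge> N" "n \<ge> N"
      then have "(norm (u m - u n))\<^sup>2 < e\<^sup>2"
        using key N by (meson le_less_trans)
      then show "norm (u m - u n) < e"
        using \<open>0 < e\<close> by (meson less_imp_le power2_less_imp_less)
    qed
  qed
  then obtain y where y: "u \<longlonglongrightarrow> y"
    using Cauchy_convergent convergent_def by blast
  have yC: "y \<in> C"
    using closed_sequentially[OF assms(1) _ y] u(1) by blast
  have "norm (x - y) \<le> d"
  proof (rule LIMSEQ_le)
    show "(\<lambda>n. norm (x - u n)) \<longlonglongrightarrow> norm (x - y)"
      by (intro tendsto_intros y)
    show "(\<lambda>n. d + 1 / Suc n) \<longlonglongrightarrow> d"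
      using tendsto_add[OF tendsto_const LIMSEQ_inverse_real_of_nat, of d] by (simp add: field_simps)
  qed (use u(2) less_imp_le in blast)
  have "inner (x - y) (z - y) \<le> 0" if z: "z \<in> C" for z
  proof (rule ccontr)
    assume neg: "\<not> ?thesis"
    define a where "a = inner (x - y) (z - y)"
    define b where "b = (norm (z - y))\<^sup>2"
    have a: "0 < a" and b: "0 \<le> b"
      using neg by (auto simp: a_def b_def)
    (* A step of length t along the segment from y to z changes the squared distance to x by
       - 2 t a + t^2 b, which is negative for this t. *)
    define t where "t = min 1 (a / (b + 1))"
    have t: "0 < t" "t \<le> 1"
      using a b by (auto simp: t_def)
    have "t * (b + 1) \<le> (a / (b + 1)) * (b + 1)"
      using b by (intro mult_right_mono) (auto simp: t_def)
    then have t3: "t * (b + 1) \<le> a"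
      using b by simp
    have "y + t *\<^sub>R (z - y) \<in> C"
      using convexD[OF assms(2) yC z, of "1 - t" t] t by (simp add: algebra_simps)
    then have "norm (x - y) \<le> norm (x - (y + t *\<^sub>R (z - y)))"
      using d \<open>norm (x - y) \<le> d\<close> order_trans by blast
    then have "(norm (x - y))\<^sup>2 \<le> (norm (x - (y + t *\<^sub>R (z - y))))\<^sup>2"
      by (intro power_mono) auto
    also have "\<dots> = (norm (x - y))\<^sup>2 - 2 * t * a + t * t * b"
      unfolding power2_norm_eq_inner a_def b_def
      by (simp add: inner_diff_left inner_diff_right inner_add_left inner_add_right
          inner_commute algebra_simps)
    finally have "t * (2 * a) \<le> t * (t * b)"
      by (simp add: algebra_simps)
    then have "2 * a \<le> t * b"
      using t(1) by simp
    then show False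
      using t t3 a by (simp add: algebra_simps)
  qed
  then show thesis
    using that yC by blast
qed

lemma orth_decomposition_closed_subspace:
  fixes V :: "'a::{real_inner, complete_space} set"
  assumes "closed V" "subspace V"
  obtains y where "y \<in> V" "\<And>z. z \<in> V \<Longrightarrow> inner (x - y) z = 0"
proof -
  obtain y where y: "y \<in> V" "\<And>z. z \<in> V \<Longrightarrow> inner (x - y) (z - y) \<le> 0"
    using closest_point_in_closed_convex[OF assms(1) subspace_imp_convex[OF assms(2)]]
      subspace_0[OF assms(2)] by blast
  have "inner (x - y) z = 0" if "z \<in> V" for z
    using y(2)[of "y + z"] y(2)[of "y - z"] that assms(2) y(1)
    by (simp add: subspace_add subspace_diff)
  then show thesis
    using that y(1) by blast
qed

text \<open>
  Orthogonality for the real inner product implies complex orthogonality, since a complex subspace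
  contains \<open>\<i> z\<close> along with \<open>z\<close>.
\<close>

lemma orth_decomposition_hilbert_subspace:
  fixes S :: "'a::complex_hilbert set"
  assumes "hilbert_subspace S"
  obtains y where "y \<in> S" "\<And>z. z \<in> S \<Longrightarrow> cinner z (x - y) = 0"
proof -
  have S: "complex_vector.subspace S" "closed S"
    using assms by (auto simp: hilbert_subspace_def)
  obtain y where y: "y \<in> S" "\<And>z. z \<in> S \<Longrightarrow> inner (x - y) z = 0"
    using orth_decomposition_closed_subspace[OF S(2) csubspace_imp_subspace[OF S(1)]] by blast
  have "cinner z (x - y) = 0" if "z \<in> S" for z
  proof -
    have "\<i> *\<^sub>C z \<in> S"
      using S(1) that by (simp add: complex_vector.subspace_scale)
    then have "cinner (x - y) z = 0"
      using y(2)[OF that] y(2)[of "\<i> *\<^sub>C z"] by (simp add: complex_eq_iff Re_cinner Im_cinner)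
    then show ?thesis
      by (metis cinner_commute complex_cnj_zero)
  qed
  then show thesis
    using that y(1) by blast
qed

lemma orth_proj_eqI:
  fixes S :: "'a::complex_hilbert set"
  assumes "hilbert_subspace S" "y \<in> S" "\<And>z. z \<in> S \<Longrightarrow> cinner z (x - y) = 0"
  shows "orth_proj S x = y"
  unfolding orth_proj_def
proof (rule the_equality)
  fix w
  assume w: "w \<in> S \<and> (\<forall>z\<in>S. cinner z (x - w) = 0)"
  have "w - y \<in> S"
    using w assms by (simp add: complex_vector.subspace_diff hilbert_subspace_def)
  then have "cinner (w - y) ((x - y) - (x - w)) = 0"
    using w assms(3) by (simp add: cinner_diff_right)
  then show "w = y"
    by (simp add: cinner_self_eq_0)
qed (use assms in auto)

lemma orth_proj_in:
  fixes S :: "'a::complex_hilbert set"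
  assumes "hilbert_subspace S"
  shows "orth_proj S x \<in> S"
  using orth_decomposition_hilbert_subspace[OF assms, of x] orth_proj_eqI[OF assms] by metis

lemma orth_proj_orth:
  fixes S :: "'a::complex_hilbert set"
  assumes "hilbert_subspace S" "z \<in> S"
  shows "cinner z (x - orth_proj S x) = 0"
  using orth_decomposition_hilbert_subspace[OF assms(1), of x] orth_proj_eqI[OF assms(1)] assms(2)
  by metis

lemma orth_proj_ident:
  fixes S :: "'a::complex_hilbert set"
  assumes "hilbert_subspace S" "x \<in> S"
  shows "orth_proj S x = x"
  by (rule orth_proj_eqI) (use assms in auto)

lemma cinner_orth_proj_right:
  fixes S :: "'a::complex_hilbert set"
  assumes "hilbert_subspace S" "z \<in> S"
  shows "cinner z (orth_proj S x) = cinner z x"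
  using orth_proj_orth[OF assms, of x] by (simp add: cinner_diff_right)

lemma cinner_orth_proj_left:
  fixes S :: "'a::complex_hilbert set"
  assumes "hilbert_subspace S" "z \<in> S"
  shows "cinner (orth_proj S x) z = cinner x z"
  using cinner_orth_proj_right[OF assms, of x] by (metis cinner_commute)

lemma orth_proj_add:
  fixes S :: "'a::complex_hilbert set"
  assumes S: "hilbert_subspace S"
  shows "orth_proj S (x + y) = orth_proj S x + orth_proj S y"
  by (rule orth_proj_eqI[OF S])
    (use S in \<open>auto simp: orth_proj_in complex_vector.subspace_add hilbert_subspace_def
      cinner_diff_right cinner_add_right cinner_orth_proj_right[OF S]\<close>)

lemma orth_proj_scaleC:
  fixes S :: "'a::complex_hilbert set"
  assumes S: "hilbert_subspace S"
  shows "orth_proj S (c *\<^sub>C x) = c *\<^sub>C orth_proj S x"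
  by (rule orth_proj_eqI[OF S])
    (use S orth_proj_in[OF S] in \<open>auto simp: complex_vector.subspace_scale hilbert_subspace_def
      cinner_diff_right cinner_scaleC_right cinner_orth_proj_right[OF S]\<close>)

lemma norm_orth_proj_le:
  fixes S :: "'a::complex_hilbert set"
  assumes S: "hilbert_subspace S"
  shows "norm (orth_proj S x) \<le> norm x"
proof -
  have "(norm (orth_proj S x))\<^sup>2 = Re (cinner (orth_proj S x) x)"
    by (metis Re_complex_of_real S cinner_orth_proj_right cinner_self orth_proj_in)
  also have "\<dots> \<le> norm (orth_proj S x) * norm x"
    by (metis Re_cinner norm_cauchy_schwarz)
  finally show ?thesis
    by (cases "norm (orth_proj S x) = 0") (auto simp: power2_eq_square)
qed

section \<open>Self-adjoint operators bounded from below\<close>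

locale semibounded_selfadjoint =
  fixes S :: "'a::complex_hilbert set" and H :: "'a operator" and c :: real
  assumes self_adjoint: "self_adjoint_on S H"
    and form_ge: "\<psi> \<in> dom H \<Longrightarrow> c * (norm \<psi>)\<^sup>2 \<le> inner \<psi> (the (H \<psi>))"
begin

abbreviation h :: "'a \<Rightarrow> 'a" where "h \<psi> \<equiv> the (H \<psi>)"

lemma hilbert: "hilbert_subspace S"
  using self_adjoint by (simp add: self_adjoint_on_def)

lemma csubspace: "complex_vector.subspace S"
  using hilbert by (simp add: hilbert_subspace_def)

lemma closed: "closed S"
  using hilbert by (simp add: hilbert_subspace_def)

lemma dom_subspace: "complex_vector.subspace (dom H)"
  using self_adjoint by (simp add: self_adjoint_on_def linear_operator_def)

lemma dense: "closure (dom H) = S"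
  using self_adjoint by (simp add: self_adjoint_on_def)

lemma hspace_eq: "hspace H = S"
  by (simp add: hspace_def dense)

lemma dom_subset: "dom H \<subseteq> S"
  using dense closure_subset[of "dom H"] by simp

lemma h_in: "\<psi> \<in> dom H \<Longrightarrow> h \<psi> \<in> S"
  using self_adjoint unfolding self_adjoint_on_def by (metis domD option.sel ranI subsetD)

lemma h_add: "\<phi> \<in> dom H \<Longrightarrow> \<psi> \<in> dom H \<Longrightarrow> h (\<phi> + \<psi>) = h \<phi> + h \<psi>"
  using self_adjoint by (auto simp: self_adjoint_on_def linear_operator_def)

lemma h_scaleC: "\<psi> \<in> dom H \<Longrightarrow> h (k *\<^sub>C \<psi>) = k *\<^sub>C h \<psi>"
  using self_adjoint by (auto simp: self_adjoint_on_def linear_operator_def)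

lemma h_scaleR: "\<psi> \<in> dom H \<Longrightarrow> h (r *\<^sub>R \<psi>) = r *\<^sub>R h \<psi>"
  using h_scaleC[of \<psi> "of_real r"] by (simp add: scaleC_complex_of_real)

lemma dom_scaleR: "\<psi> \<in> dom H \<Longrightarrow> r *\<^sub>R \<psi> \<in> dom H"
  using dom_subspace csubspace_imp_subspace subspace_scale by blast

lemma dom_add: "\<phi> \<in> dom H \<Longrightarrow> \<psi> \<in> dom H \<Longrightarrow> \<phi> + \<psi> \<in> dom H"
  using dom_subspace by (simp add: complex_vector.subspace_add)

lemma dom_scaleC: "\<psi> \<in> dom H \<Longrightarrow> k *\<^sub>C \<psi> \<in> dom H"
  using dom_subspace by (simp add: complex_vector.subspace_scale)

lemma dom_diff: "\<phi> \<in> dom H \<Longrightarrow> \<psi> \<in> dom H \<Longrightarrow> \<phi> - \<psi> \<in> dom H"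
  using dom_subspace by (simp add: complex_vector.subspace_diff)

lemma h_diff: "\<phi> \<in> dom H \<Longrightarrow> \<psi> \<in> dom H \<Longrightarrow> h (\<phi> - \<psi>) = h \<phi> - h \<psi>"
  using h_add[of "\<phi> - \<psi>" \<psi>] dom_diff[of \<phi> \<psi>] by simp

text \<open>
  Density of the domain, in the form that makes adjoints unique.
\<close>

lemma eq_zero_if_orth_dom:
  assumes "z \<in> S" "\<And>\<psi>. \<psi> \<in> dom H \<Longrightarrow> cinner z \<psi> = 0"
  shows "z = 0"
proof -
  obtain u where u: "\<And>n. u n \<in> dom H" "u \<longlonglongrightarrow> z"
    using assms(1) dense closure_sequential by metis
  have "(\<lambda>n. cinner z (u n)) \<longlonglongrightarrow> cinner z z"
    by (rule tendsto_cinner_right[OF u(2)])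
  moreover have "(\<lambda>n. cinner z (u n)) = (\<lambda>n. 0)"
    using assms(2) u(1) by blast
  ultimately show ?thesis
    by (simp add: LIMSEQ_const_iff cinner_self_eq_0)
qed

lemma adjoint_eqI:
  assumes "\<phi> \<in> S" "\<zeta> \<in> S" "\<And>\<psi>. \<psi> \<in> dom H \<Longrightarrow> cinner \<phi> (h \<psi>) = cinner \<zeta> \<psi>"
  shows "adjoint_in S H \<phi> = Some \<zeta>"
proof -
  have "(THE \<zeta>. \<zeta> \<in> S \<and> (\<forall>\<psi>\<in>dom H. cinner \<phi> (h \<psi>) = cinner \<zeta> \<psi>)) = \<zeta>"
  proof (rule the_equality)
    fix \<xi>
    assume \<xi>: "\<xi> \<in> S \<and> (\<forall>\<psi>\<in>dom H. cinner \<phi> (h \<psi>) = cinner \<xi> \<psi>)"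
    have "\<xi> - \<zeta> = 0"
      using \<xi> assms csubspace
      by (intro eq_zero_if_orth_dom) (auto simp: complex_vector.subspace_diff cinner_diff_left)
    then show "\<xi> = \<zeta>" by simp
  qed (use assms in auto)
  then show ?thesis
    using assms unfolding adjoint_in_def by auto
qed

text \<open>
  How self-adjointness is used: a vector belongs to the domain as soon as \<open>H\<close> acts on it weakly.
\<close>

lemma H_eqI:
  assumes "\<phi> \<in> S" "\<zeta> \<in> S" "\<And>\<psi>. \<psi> \<in> dom H \<Longrightarrow> cinner \<phi> (h \<psi>) = cinner \<zeta> \<psi>"
  shows "H \<phi> = Some \<zeta>"
  using adjoint_eqI[OF assms] self_adjoint by (simp add: self_adjoint_on_def)

lemma symmetric:
  assumes "\<phi> \<in> dom H" "\<psi> \<in> dom H"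
  shows "cinner \<phi> (h \<psi>) = cinner (h \<phi>) \<psi>"
proof -
  have "adjoint_in S H \<phi> \<noteq> None"
    using assms(1) self_adjoint by (auto simp: self_adjoint_on_def)
  then obtain \<zeta> where \<zeta>: "\<phi> \<in> S" "\<zeta> \<in> S" "\<forall>\<psi>\<in>dom H. cinner \<phi> (h \<psi>) = cinner \<zeta> \<psi>"
    unfolding adjoint_in_def by (metis (no_types, lifting))
  then show ?thesis
    using H_eqI[of \<phi> \<zeta>] assms(2) by simp
qed

lemma h_closed:
  assumes u: "\<And>n. u n \<in> dom H" "u \<longlonglongrightarrow> \<psi>" "(\<lambda>n. h (u n)) \<longlonglongrightarrow> \<phi>"
  shows "H \<psi> = Some \<phi>"
proof (rule H_eqI)
  show "\<psi> \<in> S"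
    using closed_sequentially[OF closed _ u(2)] u(1) dom_subset by blast
  show "\<phi> \<in> S"
    using closed_sequentially[OF closed _ u(3)] u(1) h_in by blast
  fix \<omega>
  assume \<omega>: "\<omega> \<in> dom H"
  have "(\<lambda>n. cinner (u n) (h \<omega>)) \<longlonglongrightarrow> cinner \<psi> (h \<omega>)"
    by (rule tendsto_cinner_left[OF u(2)])
  moreover have "(\<lambda>n. cinner (u n) (h \<omega>)) \<longlonglongrightarrow> cinner \<phi> \<omega>"
    using tendsto_cinner_left[OF u(3)] symmetric[OF u(1) \<omega>] by simp
  ultimately show "cinner \<psi> (h \<omega>) = cinner \<phi> \<omega>"
    by (rule LIMSEQ_unique)
qed

lemma shifted_form_ge:
  assumes "\<psi> \<in> dom H"
  shows "(c + s) * (norm \<psi>)\<^sup>2 \<le> inner \<psi> (h \<psi> + s *\<^sub>R \<psi>)"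
  using form_ge[OF assms] by (simp add: inner_add_right power2_norm_eq_inner algebra_simps)

lemma norm_shifted_ge:
  assumes "\<psi> \<in> dom H"
  shows "(c + s) * norm \<psi> \<le> norm (h \<psi> + s *\<^sub>R \<psi>)"
proof (cases "\<psi> = 0")
  case False
  have "(c + s) * norm \<psi> * norm \<psi> \<le> norm (h \<psi> + s *\<^sub>R \<psi>) * norm \<psi>"
    using shifted_form_ge[OF assms, of s] norm_cauchy_schwarz[of \<psi> "h \<psi> + s *\<^sub>R \<psi>"]
    by (simp add: power2_eq_square mult_ac)
  then show ?thesis
    using False by simp
qed auto

text \<open>
  The form bound makes \<open>H + s\<close> injective with closed range. A vector of \<open>S\<close> orthogonal to the range would
  be an eigenvector of the adjoint, that is of \<open>H\<close> itself, with eigenvalue \<open>- s\<close>, below the form bound.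
\<close>

lemma shifted_bij:
  assumes s: "0 < c + s"
  shows "bij_betw (\<lambda>\<psi>. h \<psi> + s *\<^sub>R \<psi>) (dom H) S"
proof -
  let ?g = "\<lambda>\<psi>. h \<psi> + s *\<^sub>R \<psi>"
  have g_diff: "?g (\<phi> - \<psi>) = ?g \<phi> - ?g \<psi>" if "\<phi> \<in> dom H" "\<psi> \<in> dom H" for \<phi> \<psi>
    using that by (simp add: h_diff scaleR_diff_right)
  have "inj_on ?g (dom H)"
  proof (rule inj_onI)
    fix \<phi> \<psi>
    assume *: "\<phi> \<in> dom H" "\<psi> \<in> dom H" "?g \<phi> = ?g \<psi>"
    then have "(c + s) * norm (\<phi> - \<psi>) \<le> 0"
      using norm_shifted_ge[OF dom_diff[OF *(1,2)], of s] g_diff[OF *(1,2)] by simp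
    then show "\<phi> = \<psi>"
      using s by (simp add: mult_le_0_iff)
  qed
  moreover have g_in: "?g \<psi> \<in> S" if "\<psi> \<in> dom H" for \<psi>
    using that h_in dom_subset csubspace_imp_subspace[OF csubspace]
    by (auto intro!: subspace_add subspace_scale)
  moreover have "S \<subseteq> ?g ` dom H"
  proof -
    let ?R = "?g ` dom H"
    have sub: "complex_vector.subspace ?R"
    proof (rule complex_vector.subspaceI)
      have "0 \<in> dom H"
        using dom_subspace by (rule complex_vector.subspace_0)
      then show "0 \<in> ?R"
        using h_scaleR[of 0 0] by (auto intro!: image_eqI[of _ _ 0])
    next
      fix x y assume "x \<in> ?R" "y \<in> ?R"
      then obtain \<phi> \<psi> where "\<phi> \<in> dom H" "\<psi> \<in> dom H" "x = ?g \<phi>" "y = ?g \<psi>"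
        by blast
      then show "x + y \<in> ?R"
        by (intro image_eqI[of _ _ "\<phi> + \<psi>"]) (auto simp: h_add dom_add scaleR_add_right)
    next
      fix x k assume "x \<in> ?R"
      then obtain \<phi> where "\<phi> \<in> dom H" "x = ?g \<phi>"
        by blast
      then show "k *\<^sub>C x \<in> ?R"
        by (intro image_eqI[of _ _ "k *\<^sub>C \<phi>"])
          (auto simp: h_scaleC dom_scaleC scaleC_add_right scaleC_scaleR)
    qed
    have "closed ?R"
      unfolding closed_sequential_limits
    proof (intro allI impI, elim conjE)
      fix y l
      assume y: "\<forall>n. y n \<in> ?R" and l: "y \<longlonglongrightarrow> l"
      then have "\<forall>n. \<exists>v. v \<in> dom H \<and> y n = ?g v"
        by blast
      then obtain u where u: "\<And>n. u n \<in> dom H" "\<And>n. y n = ?g (u n)"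
        by metis
      have "Cauchy u"
      proof (rule CauchyI)
        fix e :: real
        assume e: "0 < e"
        have "Cauchy y"
          using l by (rule LIMSEQ_imp_Cauchy)
        then obtain M where M: "\<And>m n. m \<ge> M \<Longrightarrow> n \<ge> M \<Longrightarrow> norm (y m - y n) < (c + s) * e"
          using CauchyD[of y "(c + s) * e"] e s by auto
        show "\<exists>M. \<forall>m\<ge>M. \<forall>n\<ge>M. norm (u m - u n) < e"
        proof (intro exI allI impI)
          fix m n
          assume "m \<ge> M" "n \<ge> M"
          then have "(c + s) * norm (u m - u n) < (c + s) * e"
            using norm_shifted_ge[OF dom_diff[OF u(1) u(1)], of s m n] g_diff[OF u(1) u(1)]
              M[of m n] u(2) by simp
          then show "norm (u m - u n) < e"
            using s by simp
        qed
      qed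
      then obtain \<psi> where \<psi>: "u \<longlonglongrightarrow> \<psi>"
        using Cauchy_convergent convergent_def by blast
      have "(\<lambda>n. y n - s *\<^sub>R u n) \<longlonglongrightarrow> l - s *\<^sub>R \<psi>"
        by (intro tendsto_intros l \<psi>)
      then have "(\<lambda>n. h (u n)) \<longlonglongrightarrow> l - s *\<^sub>R \<psi>"
        by (simp add: u(2))
      then have "H \<psi> = Some (l - s *\<^sub>R \<psi>)"
        using h_closed[OF u(1) \<psi>] by blast
      then show "l \<in> ?R"
        by (intro image_eqI[of _ _ \<psi>]) auto
    qed
    with sub have R: "hilbert_subspace ?R"
      by (simp add: hilbert_subspace_def)
    show "S \<subseteq> ?R"
    proof
      fix y
      assume y: "y \<in> S"
      define d where "d = y - orth_proj ?R y"
      have "orth_proj ?R y \<in> S"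
        using orth_proj_in[OF R, of y] g_in by (metis (no_types, lifting) imageE)
      then have d: "d \<in> S"
        using y csubspace by (simp add: d_def complex_vector.subspace_diff)
      have orth: "cinner d (?g \<psi>) = 0" if "\<psi> \<in> dom H" for \<psi>
      proof -
        have "cinner (?g \<psi>) d = 0"
          unfolding d_def by (rule orth_proj_orth[OF R]) (use that in blast)
        then show ?thesis
          by (metis cinner_commute complex_cnj_zero)
      qed
      have "H d = Some (- s *\<^sub>R d)"
      proof (rule H_eqI[OF d])
        show "- s *\<^sub>R d \<in> S"
          using d csubspace_imp_subspace[OF csubspace] subspace_scale by blast
        show "cinner d (h \<psi>) = cinner (- s *\<^sub>R d) \<psi>" if "\<psi> \<in> dom H" for \<psi>
          using orth[OF that]
          by (simp add: cinner_add_right cinner_scaleR_right cinner_scaleR_left cinner_minus_left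
              add_eq_0_iff2)
      qed
      then have "(c + s) * norm d \<le> 0"
        using norm_shifted_ge[of d s] by auto
      then have "d = 0"
        using s by (simp add: mult_le_0_iff)
      then show "y \<in> ?R"
        using orth_proj_in[OF R, of y] by (simp add: d_def)
    qed
  qed
  ultimately show ?thesis
    by (auto simp: bij_betw_def)
qed

lemma shifted_inverse_solves:
  assumes s: "0 < c + s" and \<eta>: "\<eta> \<in> S"
  shows "shifted_inverse H s \<eta> \<in> dom H"
    and "h (shifted_inverse H s \<eta>) + s *\<^sub>R shifted_inverse H s \<eta> = \<eta>"
proof -
  have "\<exists>!\<psi>. \<psi> \<in> dom H \<and> h \<psi> + s *\<^sub>R \<psi> = \<eta>"
    using bij_betw_iff_bijections[THEN iffD1, OF shifted_bij[OF s]] \<eta>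
    by (metis (no_types, lifting) bij_betw_def inj_on_def shifted_bij[OF s])
  then have "shifted_inverse H s \<eta> \<in> dom H \<and> h (shifted_inverse H s \<eta>) + s *\<^sub>R shifted_inverse H s \<eta> = \<eta>"
    unfolding shifted_inverse_def by (rule theI')
  then show "shifted_inverse H s \<eta> \<in> dom H"
    and "h (shifted_inverse H s \<eta>) + s *\<^sub>R shifted_inverse H s \<eta> = \<eta>"
    by blast+
qed

lemma shifted_inverse_eqI:
  assumes s: "0 < c + s" and \<psi>: "\<psi> \<in> dom H" "h \<psi> + s *\<^sub>R \<psi> = \<eta>"
  shows "shifted_inverse H s \<eta> = \<psi>"
proof -
  have "\<eta> \<in> S"
    using bij_betw_apply[OF shifted_bij[OF s] \<psi>(1)] \<psi>(2) by simp
  then show ?thesis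
    using shifted_inverse_solves[OF s] \<psi> bij_betw_imp_inj_on[OF shifted_bij[OF s]]
    by (metis (no_types, lifting) inj_onD)
qed

lemma shifted_inverse_add:
  assumes s: "0 < c + s" and "\<eta> \<in> S" "\<xi> \<in> S"
  shows "shifted_inverse H s (\<eta> + \<xi>) = shifted_inverse H s \<eta> + shifted_inverse H s \<xi>"
proof (rule shifted_inverse_eqI[OF s])
  let ?R = "shifted_inverse H s"
  note e = shifted_inverse_solves[OF s assms(2)] and x = shifted_inverse_solves[OF s assms(3)]
  show "?R \<eta> + ?R \<xi> \<in> dom H"
    using e x dom_add by blast
  have "h (?R \<eta> + ?R \<xi>) + s *\<^sub>R (?R \<eta> + ?R \<xi>) = (h (?R \<eta>) + s *\<^sub>R ?R \<eta>) + (h (?R \<xi>) + s *\<^sub>R ?R \<xi>)"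
    using h_add[OF e(1) x(1)] by (simp add: scaleR_add_right)
  then show "h (?R \<eta> + ?R \<xi>) + s *\<^sub>R (?R \<eta> + ?R \<xi>) = \<eta> + \<xi>"
    unfolding e x .
qed

lemma shifted_inverse_scaleC:
  assumes s: "0 < c + s" and "\<eta> \<in> S"
  shows "shifted_inverse H s (k *\<^sub>C \<eta>) = k *\<^sub>C shifted_inverse H s \<eta>"
proof (rule shifted_inverse_eqI[OF s])
  let ?R = "shifted_inverse H s"
  note e = shifted_inverse_solves[OF s assms(2)]
  show "k *\<^sub>C ?R \<eta> \<in> dom H"
    using e dom_scaleC by blast
  have "h (k *\<^sub>C ?R \<eta>) + s *\<^sub>R (k *\<^sub>C ?R \<eta>) = k *\<^sub>C (h (?R \<eta>) + s *\<^sub>R ?R \<eta>)"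
    using h_scaleC[OF e(1)] by (simp add: scaleC_add_right scaleC_scaleR)
  then show "h (k *\<^sub>C ?R \<eta>) + s *\<^sub>R (k *\<^sub>C ?R \<eta>) = k *\<^sub>C \<eta>"
    unfolding e .
qed

lemma shifted_inverse_diff:
  assumes s: "0 < c + s" and "\<eta> \<in> S" "\<xi> \<in> S"
  shows "shifted_inverse H s (\<eta> - \<xi>) = shifted_inverse H s \<eta> - shifted_inverse H s \<xi>"
  using shifted_inverse_add[OF s, of "\<eta> - \<xi>" \<xi>] assms csubspace
  by (simp add: complex_vector.subspace_diff algebra_simps)

lemma shifted_inverse_symmetric:
  assumes s: "0 < c + s" and "\<eta> \<in> S" "\<xi> \<in> S"
  shows "cinner \<eta> (shifted_inverse H s \<xi>) = cinner (shifted_inverse H s \<eta>) \<xi>"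
proof -
  let ?R = "shifted_inverse H s"
  note e = shifted_inverse_solves[OF s assms(2)] and x = shifted_inverse_solves[OF s assms(3)]
  have "cinner (h (?R \<eta>) + s *\<^sub>R ?R \<eta>) (?R \<xi>) = cinner (?R \<eta>) (h (?R \<xi>) + s *\<^sub>R ?R \<xi>)"
    using symmetric[OF e(1) x(1)]
    by (simp add: cinner_add_left cinner_add_right cinner_scaleR_left cinner_scaleR_right)
  then show ?thesis
    using e x by simp
qed

lemma norm_shifted_inverse_le:
  assumes s: "0 < c + s" and "\<eta> \<in> S"
  shows "(c + s) * norm (shifted_inverse H s \<eta>) \<le> norm \<eta>"
  using norm_shifted_ge[OF shifted_inverse_solves(1)[OF assms], of s]
    shifted_inverse_solves(2)[OF assms] by simp

text \<open>
  With \<open>m = c + s\<close> and \<open>\<phi>\<close> the image of \<open>\<eta>\<close> under the inverse, this is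
  \<open>0 \<le> \<parallel>\<eta> - m \<phi>\<parallel>\<^sup>2\<close> combined with \<open>m \<parallel>\<phi>\<parallel>\<^sup>2 \<le> \<langle>\<eta>|\<phi>\<rangle>\<close>. For \<open>c = E(H)\<close> it says that the ground state energy is
  the top of the form of the resolvent.
\<close>

lemma shifted_inverse_form_le:
  assumes s: "0 < c + s" and "\<eta> \<in> S"
  shows "(c + s) * inner \<eta> (shifted_inverse H s \<eta>) \<le> (norm \<eta>)\<^sup>2"
proof -
  let ?\<phi> = "shifted_inverse H s \<eta>" and ?m = "c + s"
  note e = shifted_inverse_solves[OF s assms(2)]
  have 1: "?m * (norm ?\<phi>)\<^sup>2 \<le> inner \<eta> ?\<phi>"
    using shifted_form_ge[OF e(1), of s] e(2) by (simp add: inner_commute)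
  have "0 \<le> (norm (\<eta> - ?m *\<^sub>R ?\<phi>))\<^sup>2"
    by simp
  also have "\<dots> = (norm \<eta>)\<^sup>2 - 2 * (?m * inner \<eta> ?\<phi>) + ?m * (?m * (norm ?\<phi>)\<^sup>2)"
    unfolding power2_norm_eq_inner
    by (simp add: inner_diff_left inner_diff_right inner_commute algebra_simps)
  also have "\<dots> \<le> (norm \<eta>)\<^sup>2 - 2 * (?m * inner \<eta> ?\<phi>) + ?m * inner \<eta> ?\<phi>"
    using 1 s by (intro add_left_mono mult_left_mono) auto
  finally show ?thesis
    by simp
qed

lemma below_in_resolvent_set:
  assumes "x < c"
  shows "complex_of_real x \<in> resolvent_set H"
proof -
  have eq: "h \<psi> - complex_of_real x *\<^sub>C \<psi> = h \<psi> + (- x) *\<^sub>R \<psi>" for \<psi>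
    by (simp add: scaleC_complex_of_real)
  have "norm \<psi> \<le> inverse (c - x) * norm (h \<psi> + (- x) *\<^sub>R \<psi>)" if "\<psi> \<in> dom H" for \<psi>
    using norm_shifted_ge[OF that, of "- x"] assms by (simp add: field_simps)
  then have "\<exists>k. \<forall>\<psi>\<in>dom H. norm \<psi> \<le> k * norm (h \<psi> + (- x) *\<^sub>R \<psi>)"
    by blast
  moreover have "bij_betw (\<lambda>\<psi>. h \<psi> + (- x) *\<^sub>R \<psi>) (dom H) S"
    using assms by (intro shifted_bij) simp
  ultimately show ?thesis
    unfolding resolvent_set_def mem_Collect_eq eq hspace_eq by blast
qed

end

section \<open>The ground state energy\<close>

text \<open>
  Let \<open>E\<close> be the infimum of the form on unit vectors. Real numbers below \<open>E\<close> are in the resolvent set. If \<open>E\<close>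
  were too, let \<open>\<phi> = (H - E)\<inverse> \<psi>\<close> for a unit vector \<open>\<psi>\<close>, and let \<open>K\<close> bound this inverse. Expanding
  the nonnegative form of \<open>H - E\<close> at \<open>\<psi> - t \<phi>\<close> gives
  \<open>0 \<le> \<langle>\<psi>|(H - E) \<psi>\<rangle> - 2 t + t\<^sup>2 K\<close>, so that the form would be at least \<open>E + 1 / K\<close> on every unit vector.
  Hence \<open>E\<close> is the least real point of the spectrum.
\<close>

lemma ground_energy_attained:
  fixes S :: "'a::complex_hilbert set"
  assumes sa: "self_adjoint_on S H" and bd: "bounded_from_below H" and S0: "S \<noteq> {0}"
  shows "semibounded_selfadjoint S H (ground_energy H)"
    and "complex_of_real (ground_energy H) \<in> spec H"
proof -
  obtain c where c: "\<And>\<psi>. \<psi> \<in> dom H \<Longrightarrow> complex_of_real (c * (norm \<psi>)\<^sup>2) \<le> cinner \<psi> (the (H \<psi>))"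
    using bd by (auto simp: bounded_from_below_def)
  have c': "c * (norm \<psi>)\<^sup>2 \<le> inner \<psi> (the (H \<psi>))" if "\<psi> \<in> dom H" for \<psi>
    using c[OF that] by (simp add: less_eq_complex_def Re_cinner)
  interpret C: semibounded_selfadjoint S H c
    by unfold_locales (use sa c' in auto)
  define F where "F = (\<lambda>\<psi>. inner \<psi> (the (H \<psi>))) ` {\<psi>\<in>dom H. norm \<psi> = 1}"
  define E where "E = Inf F"
  have "\<exists>\<psi>\<in>dom H. \<psi> \<noteq> 0"
  proof (rule ccontr)
    assume "\<not> ?thesis"
    then have "dom H = {0}"
      using complex_vector.subspace_0[OF C.dom_subspace] by blast
    then show False
      using C.dense S0 by simp
  qed
  then obtain \<psi>0 where \<psi>0: "\<psi>0 \<in> dom H" "\<psi>0 \<noteq> 0"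
    by blast
  have "F \<noteq> {}"
    unfolding F_def using \<psi>0 C.dom_scaleR[OF \<psi>0(1), of "1 / norm \<psi>0"] by auto
  have bdd: "bdd_below F"
    unfolding F_def by (rule bdd_belowI[of _ c]) (use c' in force)
  have form: "E * (norm \<psi>)\<^sup>2 \<le> inner \<psi> (the (H \<psi>))" if \<psi>: "\<psi> \<in> dom H" for \<psi>
  proof (cases "\<psi> = 0")
    case False
    let ?\<phi> = "(1 / norm \<psi>) *\<^sub>R \<psi>"
    have "?\<phi> \<in> {\<psi>\<in>dom H. norm \<psi> = 1}"
      using C.dom_scaleR[OF \<psi>, of "1 / norm \<psi>"] False by simp
    then have "inner ?\<phi> (the (H ?\<phi>)) \<in> F"
      unfolding F_def by (rule imageI)
    then have "E \<le> inner ?\<phi> (the (H ?\<phi>))"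
      unfolding E_def using bdd by (rule cInf_lower)
    also have "\<dots> = inner \<psi> (the (H \<psi>)) / (norm \<psi>)\<^sup>2"
      using C.h_scaleR[OF \<psi>] by (simp add: power2_eq_square)
    finally show ?thesis
      using False by (simp add: field_simps)
  qed auto
  interpret E: semibounded_selfadjoint S H E
    by unfold_locales (use sa form in auto)
  have spec: "complex_of_real E \<in> spec H"
  proof (rule ccontr)
    assume "\<not> ?thesis"
    then have "complex_of_real E \<in> resolvent_set H"
      by (simp add: spec_def)
    then obtain k where bij: "bij_betw (\<lambda>\<psi>. the (H \<psi>) - E *\<^sub>R \<psi>) (dom H) S"
      and k: "\<And>\<psi>. \<psi> \<in> dom H \<Longrightarrow> norm \<psi> \<le> k * norm (the (H \<psi>) - E *\<^sub>R \<psi>)"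
      unfolding resolvent_set_def E.hspace_eq by (auto simp: scaleC_complex_of_real)
    define K where "K = max k 1"
    have K: "norm \<psi> \<le> K * norm (the (H \<psi>) - E *\<^sub>R \<psi>)" if "\<psi> \<in> dom H" for \<psi>
      using k[OF that] mult_right_mono[of k K "norm (the (H \<psi>) - E *\<^sub>R \<psi>)"] by (simp add: K_def)
    have K1: "0 < K"
      by (simp add: K_def)
    have "E + 1 / K \<le> x" if x: "x \<in> F" for x
    proof -
      obtain \<psi> where \<psi>: "\<psi> \<in> dom H" "norm \<psi> = 1" "x = inner \<psi> (the (H \<psi>))"
        using x by (auto simp: F_def)
      have "\<psi> \<in> S"
        using \<psi>(1) E.dom_subset by blast
      then obtain \<phi> where \<phi>: "\<phi> \<in> dom H" "the (H \<phi>) - E *\<^sub>R \<phi> = \<psi>"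
        using bij by (metis (no_types, lifting) bij_betw_imp_surj_on imageE)
      (* This value minimizes - 2 t + t^2 K. *)
      define t where "t = 1 / K"
      have \<phi>K: "norm \<phi> \<le> K"
        using K[OF \<phi>(1)] \<phi>(2) \<psi>(2) by simp
      have d: "\<psi> - t *\<^sub>R \<phi> \<in> dom H"
        using E.dom_diff[OF \<psi>(1) E.dom_scaleR[OF \<phi>(1)]] .
      have hd: "the (H (\<psi> - t *\<^sub>R \<phi>)) - E *\<^sub>R (\<psi> - t *\<^sub>R \<phi>) = (the (H \<psi>) - E *\<^sub>R \<psi>) - t *\<^sub>R \<psi>"
      proof -
        have 1: "the (H (\<psi> - t *\<^sub>R \<phi>)) = the (H \<psi>) - t *\<^sub>R the (H \<phi>)"
          using E.h_diff[OF \<psi>(1) E.dom_scaleR[OF \<phi>(1)]] E.h_scaleR[OF \<phi>(1)] by simp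
        have 2: "the (H \<phi>) = \<psi> + E *\<^sub>R \<phi>"
          using \<phi>(2) by (simp add: algebra_simps)
        show ?thesis
          unfolding 1 2 by (simp add: algebra_simps)
      qed
      have "inner \<phi> (the (H \<psi>) - E *\<^sub>R \<psi>) = inner (the (H \<phi>) - E *\<^sub>R \<phi>) \<psi>"
        using arg_cong[OF E.symmetric[OF \<phi>(1) \<psi>(1)], of Re]
        by (simp add: inner_diff_left inner_diff_right Re_cinner)
      then have sym: "inner \<phi> (the (H \<psi>) - E *\<^sub>R \<psi>) = 1"
        using \<phi>(2) \<psi>(2) by (simp add: power2_norm_eq_inner[symmetric])
      have pp: "inner \<psi> \<psi> = 1"
        using \<psi>(2) by (simp add: power2_norm_eq_inner[symmetric])
      have "0 \<le> inner (\<psi> - t *\<^sub>R \<phi>) (the (H (\<psi> - t *\<^sub>R \<phi>)) - E *\<^sub>R (\<psi> - t *\<^sub>R \<phi>))"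
        using form[OF d] by (simp add: inner_diff_right power2_norm_eq_inner)
      also have "\<dots> = inner \<psi> (the (H \<psi>) - E *\<^sub>R \<psi>) - t * inner \<psi> \<psi>
           - t * inner \<phi> (the (H \<psi>) - E *\<^sub>R \<psi>) + t * t * inner \<phi> \<psi>"
        unfolding hd by (simp only: inner_diff_left inner_diff_right inner_scaleR_left
            inner_scaleR_right) (simp add: algebra_simps)
      also have "\<dots> = x - E - 2 * t + t * t * inner \<phi> \<psi>"
        unfolding sym pp using pp by (simp add: \<psi>(3) inner_diff_right)
      also have "\<dots> \<le> x - E - 2 * t + t * t * K"
      proof -
        have "inner \<phi> \<psi> \<le> K"
          using norm_cauchy_schwarz[of \<phi> \<psi>] \<phi>K \<psi>(2) by simp
        then show ?thesis
          by (intro add_left_mono mult_left_mono) (auto simp: t_def)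
      qed
      also have "t * t * K = t"
        using K1 by (simp add: t_def)
      finally show ?thesis
        by (simp add: t_def)
    qed
    then have "E + 1 / K \<le> E"
      unfolding E_def[of] using cInf_greatest[OF \<open>F \<noteq> {}\<close>] by (metis E_def)
    then show False
      using K1 by simp
  qed
  have "ground_energy H = E"
    unfolding ground_energy_def
  proof (rule cInf_eq_minimum)
    show "E \<in> {x. complex_of_real x \<in> spec H}"
      using spec by simp
    show "E \<le> x" if "x \<in> {x. complex_of_real x \<in> spec H}" for x
      using that E.below_in_resolvent_set[of x] by (auto simp: spec_def intro: leI)
  qed
  then show "semibounded_selfadjoint S H (ground_energy H)"
    and "complex_of_real (ground_energy H) \<in> spec H"
    using spec E.semibounded_selfadjoint_axioms by auto
qed

section \<open>The real form of a self-dual cone\<close>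

locale self_dual =
  fixes S P :: "'a::complex_hilbert set"
  assumes hilbert: "hilbert_subspace S"
    and self_dual: "self_dual_cone S P"
begin

lemma csubspace: "complex_vector.subspace S"
  using hilbert by (simp add: hilbert_subspace_def)

lemma P_subset: "P \<subseteq> S"
  using self_dual by (simp add: self_dual_cone_def convex_cone_in_def)

lemma closed_P: "closed P"
  using self_dual by (simp add: self_dual_cone_def convex_cone_in_def)

lemma convex_P: "convex P"
  using self_dual by (simp add: self_dual_cone_def convex_cone_in_def)

lemma zero_in_P: "0 \<in> P"
  using self_dual unfolding self_dual_cone_def convex_cone_in_def by blast

lemma scaleR_in_P: "x \<in> P \<Longrightarrow> 0 \<le> r \<Longrightarrow> r *\<^sub>R x \<in> P"
  using self_dual unfolding self_dual_cone_def convex_cone_in_def cone_def by blast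

lemma cinner_nonneg: "x \<in> P \<Longrightarrow> y \<in> P \<Longrightarrow> 0 \<le> cinner x y"
  using self_dual unfolding self_dual_cone_def by blast

lemma dual_in_P: "x \<in> S \<Longrightarrow> (\<And>y. y \<in> P \<Longrightarrow> 0 \<le> cinner x y) \<Longrightarrow> x \<in> P"
  using self_dual unfolding self_dual_cone_def by blast

text \<open>
  The vectors that are real with respect to the cone; by \<open>jordan_decomposition\<close> this is \<open>P - P\<close>.
\<close>

definition real_form :: "'a set" where
  "real_form = {x \<in> S. \<forall>y\<in>P. Im (cinner x y) = 0}"

lemma P_subset_real_form: "P \<subseteq> real_form"
  using P_subset cinner_nonneg by (auto simp: real_form_def less_eq_complex_def)

lemma real_form_subset: "real_form \<subseteq> S"
  by (auto simp: real_form_def)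

lemma subspace_real_form: "subspace real_form"
  unfolding subspace_def real_form_def
  using csubspace_imp_subspace[OF csubspace]
  by (auto simp: subspace_0 subspace_add subspace_scale cinner_add_left cinner_scaleR_left)

lemma closed_real_form: "closed real_form"
  unfolding closed_sequential_limits
proof (intro allI impI, elim conjE)
  fix u l
  assume u: "\<forall>n. u n \<in> real_form" and l: "u \<longlonglongrightarrow> l"
  have "l \<in> S"
    using closed_sequentially[OF _ _ l, of S] u hilbert
    by (auto simp: real_form_def hilbert_subspace_def)
  moreover have "Im (cinner l y) = 0" if "y \<in> P" for y
  proof -
    have "(\<lambda>n. Im (cinner (u n) y)) \<longlonglongrightarrow> Im (cinner l y)"
      by (intro tendsto_intros tendsto_cinner_left l)
    then show ?thesis
      using u that by (simp add: real_form_def LIMSEQ_const_iff)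
  qed
  ultimately show "l \<in> real_form"
    by (simp add: real_form_def)
qed

text \<open>
  Moreau's decomposition: \<open>p\<close> is the point of \<open>P\<close> closest to \<open>x\<close>. The variational inequality says that
  \<open>q = p - x\<close> has nonnegative inner products with \<open>P\<close>, so \<open>q \<in> P\<close> by self-duality.
\<close>

lemma jordan_decomposition:
  assumes x: "x \<in> real_form"
  obtains p q where "p \<in> P" "q \<in> P" "x = p - q" "cinner p q = 0"
proof -
  obtain p where p: "p \<in> P" "\<And>z. z \<in> P \<Longrightarrow> inner (x - p) (z - p) \<le> 0"
    using closest_point_in_closed_convex[OF closed_P convex_P] zero_in_P by blast
  have "2 *\<^sub>R p \<in> P"
    using scaleR_in_P[OF p(1)] by simp
  then have 0: "inner (x - p) p = 0"
    using p(2)[of "2 *\<^sub>R p"] p(2)[OF zero_in_P] by (simp add: scaleR_2)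
  have pq: "p - x \<in> real_form"
    using x p(1) P_subset_real_form subspace_real_form by (blast intro: subspace_diff)
  have "0 \<le> cinner (p - x) z" if "z \<in> P" for z
  proof -
    have "inner (x - p) z \<le> 0"
      using p(2)[OF that] 0 by (simp add: inner_diff_right)
    then have "0 \<le> Re (cinner (p - x) z)"
      by (simp add: Re_cinner inner_diff_left)
    then show ?thesis
      using pq that by (simp add: real_form_def less_eq_complex_def)
  qed
  then have "p - x \<in> P"
    using dual_in_P pq real_form_subset by blast
  moreover have "cinner (p - x) p = 0"
    using pq p(1) 0 by (simp add: complex_eq_iff Re_cinner real_form_def inner_diff_left)
  then have "cinner p (p - x) = 0"
    by (metis cinner_commute complex_cnj_zero)
  ultimately show thesis
    using that[of p "p - x"] p(1) by simp
qed

text \<open>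
  Take for \<open>a\<close> the real-orthogonal projection of \<open>x\<close>. The remainder has purely imaginary complex inner products with \<open>P\<close>,
  so it is \<open>\<i>\<close> times a real vector.
\<close>

lemma real_form_decomposition:
  assumes x: "x \<in> S"
  obtains a b where "a \<in> real_form" "b \<in> real_form" "x = a + \<i> *\<^sub>C b"
proof -
  obtain a where a: "a \<in> real_form" "\<And>z. z \<in> real_form \<Longrightarrow> inner (x - a) z = 0"
    using orth_decomposition_closed_subspace[OF closed_real_form subspace_real_form] by blast
  define b where "b = (- \<i>) *\<^sub>C (x - a)"
  have "x - a \<in> S"
    using x a(1) real_form_subset csubspace by (blast intro: complex_vector.subspace_diff)
  then have "b \<in> S"
    unfolding b_def using csubspace by (blast intro: complex_vector.subspace_scale)
  moreover have "Im (cinner b y) = 0" if "y \<in> P" for y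
    using a(2)[of y] that P_subset_real_form
    by (auto simp: b_def cinner_scaleC_left Re_cinner simp del: complex_vector.scale_minus_left)
  ultimately have "b \<in> real_form"
    by (simp add: real_form_def)
  moreover have "\<i> *\<^sub>C b = x - a"
    by (simp add: b_def scaleC_scaleC)
  ultimately show thesis
    using that[OF a(1)] by simp
qed

lemma real_form_independent:
  assumes ab: "a \<in> real_form" "b \<in> real_form" and 0: "a + \<i> *\<^sub>C b = 0"
  shows "a = 0" "b = 0"
proof -
  have eq0: "cinner a y = 0 \<and> cinner b y = 0" if "y \<in> P" for y
  proof -
    have "cinner a y - \<i> * cinner b y = 0"
      using arg_cong[OF 0, of "\<lambda>x. cinner x y"] by (simp add: cinner_add_left cinner_scaleC_left)
    then show ?thesis
      using ab that by (auto simp: real_form_def complex_eq_iff)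
  qed
  have *: "x = 0" if "x \<in> real_form" "\<And>y. y \<in> P \<Longrightarrow> cinner x y = 0" for x
  proof -
    have "x \<in> P"
      using that real_form_subset by (intro dual_in_P) auto
    then show ?thesis
      using that(2)[of x] by (simp add: cinner_self_eq_0)
  qed
  show "a = 0" "b = 0"
    using *[OF ab(1)] *[OF ab(2)] eq0 by blast+
qed

end

section \<open>A Perron-Frobenius theorem for self-dual cones\<close>

text \<open>
  The argument uses the resolvent \<open>R = (H + s)\<inverse>\<close> at \<open>s = 1 - E(H)\<close>, for which ground states are the fixed
  points of \<open>R\<close> and \<open>\<langle>x|R x\<rangle> \<le> \<parallel>x\<parallel>\<^sup>2\<close>. Since \<open>R\<close> preserves \<open>P - P\<close>, the real and imaginary parts of a fixed point are fixed
  points. A nonzero real fixed point \<open>p - q\<close> has \<open>p = 0\<close> or \<open>q = 0\<close>, so up to sign it is the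
  image under \<open>R\<close> of a nonzero vector of \<open>P\<close> and thus strictly positive. Two strictly positive vectors are never
  orthogonal, which leaves no room for a second dimension.
\<close>

lemma strictly_positive_ground_state:
  fixes S P :: "'a::complex_hilbert set"
  assumes hilbert: "hilbert_subspace S" and sd: "self_dual_cone S P" and H: "H \<in> A_plus S P"
  obtains \<psi> where "strictly_positive P \<psi>" "\<psi> \<noteq> 0"
    "eigenspace H (complex_of_real (ground_energy H)) = range (\<lambda>k. k *\<^sub>C \<psi>)"
proof -
  define E where "E = ground_energy H"
  have sa: "self_adjoint_on S H" and bd: "bounded_from_below H" and S0: "S \<noteq> {0}"
    and disc: "purely_discrete_spec H"
    and improving: "\<And>s. s > - E \<Longrightarrow> positivity_improving P (shifted_inverse H s)"
    using H by (auto simp: A_plus_def E_def)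
  interpret semibounded_selfadjoint S H E
    unfolding E_def by (rule ground_energy_attained[OF sa bd S0])
  interpret self_dual S P
    by unfold_locales (use hilbert sd in auto)
  have "complex_of_real E \<in> discrete_spec H"
    using ground_energy_attained(2)[OF sa bd S0] disc
    by (auto simp: purely_discrete_spec_def essential_spec_def E_def)
  then have ne: "eigenspace H E \<noteq> {0}"
    by (simp add: discrete_spec_def)

  define s where "s = 1 - E"
  have s: "0 < E + s" "E + s = 1"
    by (simp_all add: s_def)
  define R where "R = shifted_inverse H s"
  note R_solves = shifted_inverse_solves[OF s(1), folded R_def]
    and R_eqI = shifted_inverse_eqI[OF s(1), folded R_def]
    and R_add = shifted_inverse_add[OF s(1), folded R_def]
    and R_diff = shifted_inverse_diff[OF s(1), folded R_def]
    and R_scaleC = shifted_inverse_scaleC[OF s(1), folded R_def]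
    and R_symmetric = shifted_inverse_symmetric[OF s(1), folded R_def]
  have R_form: "inner x (R x) \<le> (norm x)\<^sup>2" if "x \<in> S" for x
    using shifted_inverse_form_le[OF s(1) that] s(2) by (simp add: R_def)
  have R0: "R 0 = 0"
    using R_diff[of 0 0] complex_vector.subspace_0[OF local.csubspace] by simp
  have R_pos: "strictly_positive P (R x)" if "x \<in> P" "x \<noteq> 0" for x
    using improving[of s] that by (simp add: s_def positivity_improving_def R_def)
  have R_P: "R x \<in> P" if "x \<in> P" for x
    using R_pos[OF that] R0 zero_in_P by (cases "x = 0") (auto simp: strictly_positive_def)
  have R_real: "R x \<in> real_form" if x: "x \<in> real_form" for x
  proof -
    obtain p q where pq: "p \<in> P" "q \<in> P" "x = p - q"
      using jordan_decomposition[OF x] by blast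
    then have "R x = R p - R q"
      using P_subset by (auto intro: R_diff)
    then show ?thesis
      using R_P pq P_subset_real_form subspace_real_form by (metis subsetD subspace_diff)
  qed

  have eigen_iff: "x \<in> eigenspace H E \<longleftrightarrow> x \<in> S \<and> R x = x" for x
  proof
    assume "x \<in> eigenspace H E"
    then have x: "x \<in> dom H" "h x = E *\<^sub>R x"
      by (auto simp: eigenspace_def scaleC_complex_of_real)
    then have "h x + s *\<^sub>R x = x"
      using s(2) by (simp flip: scaleR_left.add)
    then show "x \<in> S \<and> R x = x"
      using R_eqI[OF x(1)] x(1) dom_subset by blast
  next
    assume x: "x \<in> S \<and> R x = x"
    then have "x \<in> dom H" "h x + s *\<^sub>R x = x"
      using R_solves[of x] by auto
    then show "x \<in> eigenspace H E"
      by (simp add: eigenspace_def scaleC_complex_of_real s_def algebra_simps)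
  qed

  have fixed_pos: "strictly_positive P a \<or> strictly_positive P (- a)"
    if a: "a \<in> real_form" "R a = a" "a \<noteq> 0" for a
  proof -
    obtain p q where pq: "p \<in> P" "q \<in> P" "a = p - q" "cinner p q = 0"
      using jordan_decomposition[OF a(1)] by blast
    have S: "p \<in> S" "q \<in> S"
      using pq P_subset by auto
    have "p = 0 \<or> q = 0"
    proof (rule ccontr)
      assume "\<not> ?thesis"
      then have pos: "0 < cinner p (R q)" "0 < cinner q (R p)"
        using R_pos[OF pq(1)] R_pos[OF pq(2)] pq by (auto simp: strictly_positive_def)
      have pq0: "inner p q = 0"
        using pq(4) Re_cinner[of p q] by simp
      (* Passing from p - q to p + q keeps the norm but adds 2 <p|R q> + 2 <q|R p> to the form of R,
         although p - q already attains the upper bound. *)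
      have "inner (p + q) (R (p + q)) \<le> (norm (p + q))\<^sup>2"
        using S csubspace by (intro R_form) (simp add: complex_vector.subspace_add)
      also have "\<dots> = inner (p - q) (p - q)"
        using pq0 by (simp add: power2_norm_eq_inner inner_add_left inner_add_right
            inner_diff_left inner_diff_right inner_commute)
      also have "\<dots> = inner (p - q) (R p - R q)"
        using a(2) R_diff[OF S] pq(3) by simp
      finally have "inner p (R q) + inner q (R p) \<le> 0"
        using R_add[OF S] by (simp add: inner_add_left inner_add_right inner_diff_left
            inner_diff_right)
      then show False
        using pos by (simp add: less_complex_def Re_cinner)
    qed
    then show ?thesis
    proof
      assume "p = 0"
      moreover have "R q = q"
        using a(2) R_diff[OF S] R0 \<open>p = 0\<close> pq(3) by simp
      ultimately show ?thesis
        using R_pos[OF pq(2)] a(3) pq(3) by auto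
    next
      assume "q = 0"
      then show ?thesis
        using R_pos[OF pq(1)] a(2,3) pq(3) by auto
    qed
  qed

  have parts: "R a = a \<and> R b = b"
    if ab: "a \<in> real_form" "b \<in> real_form" and x: "R (a + \<i> *\<^sub>C b) = a + \<i> *\<^sub>C b" for a b
  proof -
    have S: "a \<in> S" "b \<in> S" "\<i> *\<^sub>C b \<in> S"
      using ab real_form_subset csubspace by (auto simp: complex_vector.subspace_scale)
    have "(R a - a) + \<i> *\<^sub>C (R b - b) = R (a + \<i> *\<^sub>C b) - (a + \<i> *\<^sub>C b)"
      using R_add[OF S(1,3)] R_scaleC[OF S(2)]
      by (simp add: complex_vector.scale_right_diff_distrib)
    also have "\<dots> = 0"
      using x by simp
    finally have 0: "(R a - a) + \<i> *\<^sub>C (R b - b) = 0" .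
    have "R a - a \<in> real_form" "R b - b \<in> real_form"
      using R_real ab subspace_real_form by (blast intro: subspace_diff)+
    from real_form_independent[OF this 0] show ?thesis
      by simp
  qed

  obtain \<psi> where \<psi>: "strictly_positive P \<psi>" "R \<psi> = \<psi>" "\<psi> \<noteq> 0"
  proof -
    have "0 \<in> eigenspace H E"
      using eigen_iff R0 zero_in_P P_subset by blast
    then obtain x where x: "x \<in> S" "R x = x" "x \<noteq> 0"
      using ne eigen_iff by blast
    obtain a b where ab: "a \<in> real_form" "b \<in> real_form" "x = a + \<i> *\<^sub>C b"
      using real_form_decomposition[OF x(1)] by blast
    then have R: "R a = a" "R b = b"
      using parts x(2) by blast+
    have "\<exists>a\<in>real_form. R a = a \<and> a \<noteq> 0"
    proof (cases "a = 0")
      case True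
      then have "b \<noteq> 0"
        using ab(3) x(3) by auto
      then show ?thesis using ab R by blast
    qed (use ab R in blast)
    then obtain a where a: "a \<in> real_form" "R a = a" "a \<noteq> 0"
      by blast
    have "R (- a) = - a"
      using R_diff[of 0 a] R0 a real_form_subset P_subset zero_in_P by auto
    then show thesis
      using fixed_pos[OF a] that[of a] that[of "- a"] a by auto
  qed
  have \<psi>P: "\<psi> \<in> P" "\<psi> \<in> S"
    using \<psi>(1) P_subset by (auto simp: strictly_positive_def)
  have "eigenspace H E = range (\<lambda>k. k *\<^sub>C \<psi>)"
  proof
    show "range (\<lambda>k. k *\<^sub>C \<psi>) \<subseteq> eigenspace H E"
      using eigen_iff R_scaleC[OF \<psi>P(2)] \<psi>(2) \<psi>P(2) csubspace
      by (auto simp: complex_vector.subspace_scale)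
    show "eigenspace H E \<subseteq> range (\<lambda>k. k *\<^sub>C \<psi>)"
    proof
      fix x
      assume "x \<in> eigenspace H E"
      then have x: "x \<in> S" "R x = x"
        using eigen_iff by auto
      define k where "k = cinner \<psi> x / cinner \<psi> \<psi>"
      define y where "y = x - k *\<^sub>C \<psi>"
      have k\<psi>: "k *\<^sub>C \<psi> \<in> S"
        using \<psi>P csubspace by (simp add: complex_vector.subspace_scale)
      then have y: "y \<in> S" "R y = y"
        using x R_diff[OF x(1) k\<psi>] R_scaleC[OF \<psi>P(2)] \<psi>(2) csubspace
        by (auto simp: y_def complex_vector.subspace_diff)
      have orth: "cinner \<psi> y = 0"
        using \<psi>(3) by (simp add: y_def k_def cinner_diff_right cinner_scaleC_right cinner_self_eq_0)
      obtain a b where ab: "a \<in> real_form" "b \<in> real_form" "y = a + \<i> *\<^sub>C b"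
        using real_form_decomposition[OF y(1)] by blast
      then have R: "R a = a" "R b = b"
        using parts y(2) by blast+
      have real: "Im (cinner \<psi> z) = 0" if "z \<in> real_form" for z
        using that \<psi>P(1) cinner_commute[of \<psi> z] by (simp add: real_form_def)
      have "cinner \<psi> a + \<i> * cinner \<psi> b = 0"
        using orth by (simp add: ab(3) cinner_add_right cinner_scaleC_right)
      then have 0: "cinner \<psi> a = 0" "cinner \<psi> b = 0"
        using real[OF ab(1)] real[OF ab(2)] by (auto simp: complex_eq_iff)
      have zero: "z = 0" if z: "z \<in> real_form" "R z = z" "cinner \<psi> z = 0" for z
      proof (rule ccontr)
        assume nz: "z \<noteq> 0"
        then have "0 < cinner \<psi> z \<or> 0 < cinner \<psi> (- z)"
          using fixed_pos[OF z(1,2)] \<psi>P(1) \<psi>(3) by (auto simp: strictly_positive_def)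
        then show False
          using z(3) by (simp add: cinner_minus_right)
      qed
      have "y = 0"
        using zero[OF ab(1) R(1) 0(1)] zero[OF ab(2) R(2) 0(2)] ab(3) by simp
      then show "x \<in> range (\<lambda>k. k *\<^sub>C \<psi>)"
        unfolding y_def by (intro image_eqI[of _ _ k]) auto
    qed
  qed
  then show thesis
    using that[OF \<psi>(1,3)] by (simp add: E_def)
qed

section \<open>Exponentials of bounded operators\<close>

definition op_exp :: "('b::banach \<Rightarrow> 'b) \<Rightarrow> real \<Rightarrow> 'b \<Rightarrow> 'b" where
  "op_exp D t x = (\<Sum>k. (t ^ k / fact k) *\<^sub>R (D ^^ k) x)"

lemma norm_funpow_le:
  fixes D :: "'b::real_normed_vector \<Rightarrow> 'b"
  assumes D: "bounded_linear D"
  shows "norm ((D ^^ k) x) \<le> onorm D ^ k * norm x"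
proof (induction k)
  case (Suc k)
  have "norm (D ((D ^^ k) x)) \<le> onorm D * norm ((D ^^ k) x)"
    by (rule onorm[OF D])
  also have "\<dots> \<le> onorm D * (onorm D ^ k * norm x)"
    using Suc onorm_pos_le[OF D] by (rule mult_left_mono)
  finally show ?case
    by (simp add: mult.assoc)
qed auto

lemma op_exp_term_bound:
  fixes D :: "'b::real_normed_vector \<Rightarrow> 'b"
  assumes D: "bounded_linear D" and t: "\<bar>t\<bar> \<le> r"
  shows "norm ((t ^ k / fact k) *\<^sub>R (D ^^ k) x) \<le> inverse (fact k) * (r * onorm D) ^ k * norm x"
proof -
  have "norm ((t ^ k / fact k) *\<^sub>R (D ^^ k) x) = \<bar>t\<bar> ^ k * norm ((D ^^ k) x) / fact k"
    by (simp add: power_abs)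
  also have "\<dots> \<le> r ^ k * (onorm D ^ k * norm x) / fact k"
    using t by (intro divide_right_mono mult_mono power_mono norm_funpow_le[OF D]) auto
  finally show ?thesis
    by (simp add: power_mult_distrib field_simps)
qed

lemma summable_op_exp_bound: "summable (\<lambda>k. inverse (fact k) * r ^ k * b)"
  for r b :: real
  using summable_mult2[OF summable_exp[of r], of b] .

lemma op_exp_sums:
  fixes D :: "'b::banach \<Rightarrow> 'b"
  assumes D: "bounded_linear D"
  shows "(\<lambda>k. (t ^ k / fact k) *\<^sub>R (D ^^ k) x) sums op_exp D t x"
  unfolding op_exp_def
proof (rule summable_sums, rule summable_comparison_test'[OF summable_op_exp_bound])
  show "norm ((t ^ k / fact k) *\<^sub>R (D ^^ k) x)
      \<le> inverse (fact k) * (\<bar>t\<bar> * onorm D) ^ k * norm x" if "0 \<le> k" for k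
    by (rule op_exp_term_bound[OF D order_refl])
qed

lemma op_exp_0: "op_exp D 0 x = x"
  using suminf_finite[of "{0}" "\<lambda>k. (0 ^ k / fact k) *\<^sub>R (D ^^ k) x"] by (simp add: op_exp_def)

lemma op_exp_commute:
  fixes D :: "'b::banach \<Rightarrow> 'b"
  assumes D: "bounded_linear D" and C: "bounded_linear C" and comm: "\<And>x. C (D x) = D (C x)"
  shows "C (op_exp D t x) = op_exp D t (C x)"
proof -
  have pow: "C ((D ^^ k) x) = (D ^^ k) (C x)" for k
    by (induction k) (simp_all add: comm)
  have "(\<lambda>k. C ((t ^ k / fact k) *\<^sub>R (D ^^ k) x)) sums C (op_exp D t x)"
    by (rule bounded_linear.sums[OF C op_exp_sums[OF D]])
  then have "(\<lambda>k. (t ^ k / fact k) *\<^sub>R (D ^^ k) (C x)) sums C (op_exp D t x)"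
    by (simp add: pow linear_cmul[OF bounded_linear.linear[OF C]])
  then show ?thesis
    using op_exp_sums[OF D] sums_unique2 by blast
qed

lemma op_exp_add:
  fixes D :: "'b::banach \<Rightarrow> 'b"
  assumes D: "bounded_linear D"
  shows "op_exp D t (x + y) = op_exp D t x + op_exp D t y"
proof -
  have pow: "(D ^^ k) (x + y) = (D ^^ k) x + (D ^^ k) y" for k
    by (induction k) (simp_all add: linear_add[OF bounded_linear.linear[OF D]])
  show ?thesis
    using sums_add[OF op_exp_sums[OF D, of t x] op_exp_sums[OF D, of t y]]
      op_exp_sums[OF D, of t "x + y"] sums_unique2
    by (simp add: pow scaleR_add_right)
qed

lemma op_exp_in_closed_subspace:
  fixes D :: "'b::banach \<Rightarrow> 'b"
  assumes D: "bounded_linear D" and S: "closed S" "subspace S"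
    and inv: "\<And>x. x \<in> S \<Longrightarrow> D x \<in> S" and x: "x \<in> S"
  shows "op_exp D t x \<in> S"
proof -
  have "(D ^^ k) x \<in> S" for k
    by (induction k) (simp_all add: x inv)
  then have "(\<Sum>k<n. (t ^ k / fact k) *\<^sub>R (D ^^ k) x) \<in> S" for n
    by (intro subspace_sum subspace_scale S)
  then show ?thesis
    using closed_sequentially[OF S(1) _ op_exp_sums[OF D, unfolded sums_def]] by blast
qed

text \<open>
  Termwise differentiation on a bounded interval. The termwise derivatives are again the terms of an exponential
  series, shifted by one index and with \<open>D x\<close> in place of \<open>x\<close>.
\<close>

lemma has_vector_derivative_op_exp:
  fixes D :: "'b::banach \<Rightarrow> 'b"
  assumes D: "bounded_linear D"
  shows "((\<lambda>t. op_exp D t x) has_vector_derivative D (op_exp D t x)) (at t)"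
proof -
  define r where "r = \<bar>t\<bar> + 1"
  let ?A = "{-r<..<r}"
  define f where "f i u = (u ^ i / fact i) *\<^sub>R (D ^^ i) x" for i and u :: real
  (* The derivative of the i-th term; M dominates its norm on the interval. *)
  define d where "d i u = (if i = 0 then 0 else (u ^ (i - 1) / fact (i - 1)) *\<^sub>R (D ^^ (i - 1)) (D x))"
    for i and u :: real
  define M where
    "M i = (if i = 0 then 0 else inverse (fact (i - 1)) * (r * onorm D) ^ (i - 1) * norm (D x))"
    for i :: nat
  have t: "t \<in> ?A"
    by (auto simp: r_def)
  have f_deriv: "(f i has_vector_derivative d i u) (at u within ?A)" for i u
  proof (cases i)
    case 0
    then have "f i = (\<lambda>u. x)" "d i u = 0"
      by (auto simp: f_def d_def fun_eq_iff)
    then show ?thesis by simp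
  next
    case (Suc j)
    have "((\<lambda>u. u ^ i / fact i) has_real_derivative (real i * u ^ (i - Suc 0) / fact i)) (at u within ?A)"
      by (intro DERIV_cdivide has_field_derivative_at_within[OF DERIV_pow])
    also have "real i * u ^ (i - Suc 0) / fact i = u ^ j / fact j"
      using Suc by (simp add: field_simps del: of_nat_Suc)
    finally have "((\<lambda>u. u ^ i / fact i) has_real_derivative (u ^ j / fact j)) (at u within ?A)" .
    then have "((\<lambda>u. (u ^ i / fact i) *\<^sub>R (D ^^ i) x) has_vector_derivative
        (u ^ j / fact j) *\<^sub>R (D ^^ i) x) (at u within ?A)"
      unfolding has_real_derivative_iff_has_vector_derivative
      by (rule bounded_linear.has_vector_derivative[OF bounded_linear_scaleR_left])
    moreover have "(D ^^ i) x = (D ^^ j) (D x)"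
      using Suc by (simp add: funpow_swap1)
    ultimately show ?thesis
      unfolding f_def d_def using Suc by simp
  qed
  have "summable M"
    using summable_op_exp_bound[of "r * onorm D" "norm (D x)"]
    by (subst summable_Suc_iff[symmetric]) (simp add: M_def)
  moreover have "norm (d i u) \<le> M i" if "u \<in> ?A" for i u
  proof -
    have "\<bar>u\<bar> \<le> r"
      using that by auto
    from op_exp_term_bound[OF D this, of "i - 1" "D x"] show ?thesis
      by (simp add: d_def M_def)
  qed
  ultimately have unif: "uniform_limit ?A (\<lambda>n u. \<Sum>i<n. d i u) (\<lambda>u. \<Sum>i. d i u) sequentially"
    by (intro Weierstrass_m_test)
  have d_sum: "(\<Sum>i. d i u) = D (op_exp D u x)" for u
  proof -
    have "(\<lambda>i. d (Suc i) u) sums op_exp D u (D x)"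
      using op_exp_sums[OF D, of u "D x"] by (simp add: d_def)
    then have "(\<lambda>i. d i u) sums op_exp D u (D x)"
      by (subst (asm) sums_Suc_iff) (simp add: d_def)
    then show ?thesis
      using op_exp_commute[OF D D] sums_unique by fastforce
  qed
  have "\<exists>g. \<forall>u\<in>?A. (\<lambda>n. f n u) sums g u \<and>
      (g has_derivative (\<lambda>h. h *\<^sub>R D (op_exp D u x))) (at u within ?A)"
  proof (rule has_derivative_series)
    show "(f n has_derivative (\<lambda>h. h *\<^sub>R d n u)) (at u within ?A)" for n u
      using f_deriv by (simp add: has_vector_derivative_def)
    show "\<forall>\<^sub>F n in sequentially. \<forall>u\<in>?A. \<forall>h.
        norm ((\<Sum>i<n. h *\<^sub>R d i u) - h *\<^sub>R D (op_exp D u x)) \<le> e * norm h" if "e > 0" for e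
      using uniform_limitD[OF unif that]
    proof eventually_elim
      case (elim n)
      show ?case
      proof (intro ballI allI)
        fix u h
        assume "u \<in> ?A"
        then have "norm ((\<Sum>i<n. d i u) - D (op_exp D u x)) \<le> e"
          using elim by (simp add: dist_norm d_sum less_imp_le)
        then have "\<bar>h\<bar> * norm ((\<Sum>i<n. d i u) - D (op_exp D u x)) \<le> \<bar>h\<bar> * e"
          by (intro mult_left_mono) auto
        then show "norm ((\<Sum>i<n. h *\<^sub>R d i u) - h *\<^sub>R D (op_exp D u x)) \<le> e * norm h"
          by (simp flip: scaleR_sum_right scaleR_diff_right) (simp add: mult.commute)
      qed
    qed
    show "(\<lambda>n. f n t) sums op_exp D t x"
      using op_exp_sums[OF D] by (simp add: f_def)
  qed (use t in auto)
  then obtain g where g: "\<And>u. u \<in> ?A \<Longrightarrow> (\<lambda>n. f n u) sums g u"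
    "\<And>u. u \<in> ?A \<Longrightarrow> (g has_derivative (\<lambda>h. h *\<^sub>R D (op_exp D u x))) (at u within ?A)"
    by blast
  have "g u = op_exp D u x" if "u \<in> ?A" for u
    using g(1)[OF that] op_exp_sums[OF D, of u x] sums_unique2 by (auto simp: f_def)
  then have "((\<lambda>t. op_exp D t x) has_derivative (\<lambda>h. h *\<^sub>R D (op_exp D t x))) (at t within ?A)"
    using g(2)[OF t] t by (metis (no_types, lifting) has_derivative_transform)
  then show ?thesis
    using t by (simp add: has_vector_derivative_def at_within_open[OF t])
qed

section \<open>Evolution equations with a skew-symmetric generator\<close>

lemma has_real_derivative_inner:
  fixes u v :: "real \<Rightarrow> 'b::real_inner"
  assumes "(u has_vector_derivative u') (at t)" "(v has_vector_derivative v') (at t)"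
  shows "((\<lambda>t. inner (u t) (v t)) has_real_derivative (inner u' (v t) + inner (u t) v')) (at t)"
  using has_derivative_inner[OF assms[unfolded has_vector_derivative_def]]
  unfolding has_field_derivative_def
  by (rule has_derivative_eq_rhs) (auto simp: algebra_simps fun_eq_iff)

lemma norm_const_if_orthogonal_derivative:
  fixes w :: "real \<Rightarrow> 'b::real_inner"
  assumes "\<And>t. (w has_vector_derivative w' t) (at t)" and "\<And>t. inner (w t) (w' t) = 0"
  shows "norm (w t) = norm (w 0)"
proof -
  have "((\<lambda>t. inner (w t) (w t)) has_real_derivative 0) (at t)" for t
    using has_real_derivative_inner[OF assms(1) assms(1), of t] assms(2)
    by (simp add: inner_commute)
  then have "inner (w t) (w t) = inner (w 0) (w 0)"
    by (intro DERIV_isconst_all) blast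
  then show ?thesis
    by (simp add: norm_eq_sqrt_inner)
qed

lemma norm_op_exp:
  fixes D :: "'b::{real_inner, banach} \<Rightarrow> 'b"
  assumes "bounded_linear D" "\<And>x. inner x (D x) = 0"
  shows "norm (op_exp D t x) = norm x"
  using norm_const_if_orthogonal_derivative[OF has_vector_derivative_op_exp[OF assms(1)]] assms(2)
  by (metis op_exp_0)

text \<open>
  Duhamel's estimate for \<open>w' = D w + g\<close>, on which the remaining estimates of this section and the convergence of the Yosida
  approximation rest. It is obtained without an integral: pairing \<open>w\<close> with the backward solution \<open>v t = exp ((t - T) D) (w T)\<close>
  of the homogeneous equation cancels the terms in \<open>D\<close>, so that \<open>\<langle>v t|w t\<rangle>\<close> has derivative \<open>\<langle>v t|g t\<rangle>\<close> and grows from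
  \<open>0\<close> to \<open>\<parallel>w T\<parallel>\<^sup>2\<close>.
\<close>

lemma inhomogeneous_skew_evolution_bound:
  fixes D :: "'b::{real_inner, banach} \<Rightarrow> 'b"
  assumes D: "bounded_linear D" and skew: "\<And>x. inner x (D x) = 0"
    and w: "\<And>t. (w has_vector_derivative D (w t) + g t) (at t)" and w0: "w 0 = 0"
    and g: "\<And>t. \<bar>t\<bar> \<le> \<bar>T\<bar> \<Longrightarrow> norm (g t) \<le> B"
  shows "norm (w T) \<le> \<bar>T\<bar> * B"
proof (cases "w T = 0")
  case True
  have "0 \<le> B"
    using order_trans[OF norm_ge_zero g[of 0]] by simp
  then show ?thesis
    using True by simp
next
  case False
  interpret D: bounded_linear D by fact
  have skew': "inner (D x) y = - inner x (D y)" for x y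
    using skew[of "x + y"] skew[of x] skew[of y] inner_commute[of "D x" y]
    by (simp add: D.add inner_add_left inner_add_right)
  (* The test solution v ends in the vector whose norm is to be bounded. *)
  define z where "z = w T"
  define v where "v t = op_exp D (t - T) z" for t
  have v: "(v has_vector_derivative D (v t)) (at t)" for t
  proof -
    have "((\<lambda>t. t - T) has_vector_derivative 1) (at t)"
      by (auto intro!: derivative_eq_intros)
    from vector_diff_chain_at[OF this has_vector_derivative_op_exp[OF D, of z "t - T"]]
    show ?thesis
      by (simp add: o_def v_def[abs_def])
  qed
  have nv: "norm (v t) = norm z" for t
    by (simp add: v_def norm_op_exp[OF D skew])
  have der: "((\<lambda>t. inner (v t) (w t)) has_real_derivative inner (v t) (g t)) (at t)" for t
    using has_real_derivative_inner[OF v w, of t] by (simp add: skew' inner_add_right)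
  have "norm (inner (v T) (w T) - inner (v 0) (w 0)) \<le> (norm z * B) * norm (T - 0)"
  proof (rule field_differentiable_bound[of "closed_segment 0 T"])
    show "((\<lambda>t. inner (v t) (w t)) has_field_derivative inner (v t) (g t))
        (at t within closed_segment 0 T)" for t
      using der by (rule has_field_derivative_at_within)
    show "norm (inner (v t) (g t)) \<le> norm z * B" if "t \<in> closed_segment 0 T" for t
    proof -
      have "\<bar>t\<bar> \<le> \<bar>T\<bar>"
        using that by (auto simp: closed_segment_eq_real_ivl split: if_splits)
      then have "norm (v t) * norm (g t) \<le> norm z * B"
        using g nv by (intro mult_mono) auto
      then show ?thesis
        using Cauchy_Schwarz_ineq2[of "v t" "g t"] by simp
    qed
  qed auto
  moreover have "v T = z"
    by (simp add: v_def op_exp_0)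
  ultimately have "norm z * norm z \<le> norm z * (\<bar>T\<bar> * B)"
    using w0 by (simp add: z_def[symmetric] power2_norm_eq_inner[symmetric] power2_eq_square mult_ac)
  then show ?thesis
    using False by (simp add: z_def)
qed

lemma op_exp_group:
  fixes D :: "'b::{real_inner, banach} \<Rightarrow> 'b"
  assumes D: "bounded_linear D" and skew: "\<And>x. inner x (D x) = 0"
  shows "op_exp D (s + t) x = op_exp D s (op_exp D t x)"
proof -
  interpret D: bounded_linear D by fact
  define w where "w s = op_exp D (s + t) x - op_exp D s (op_exp D t x)" for s
  have "(w has_vector_derivative D (w s) + 0) (at s)" for s
  proof -
    have "((\<lambda>s. s + t) has_vector_derivative 1) (at s)"
      by (auto intro!: derivative_eq_intros)
    from vector_diff_chain_at[OF this has_vector_derivative_op_exp[OF D, of x "s + t"]]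
    have "((\<lambda>s. op_exp D (s + t) x) has_vector_derivative D (op_exp D (s + t) x)) (at s)"
      by (simp add: o_def)
    from has_vector_derivative_diff[OF this has_vector_derivative_op_exp[OF D, of "op_exp D t x" s]]
    show ?thesis
      by (simp add: w_def[abs_def] D.diff)
  qed
  then have "norm (w s) \<le> \<bar>s\<bar> * 0"
    by (rule inhomogeneous_skew_evolution_bound[OF D skew]) (auto simp: w_def op_exp_0)
  then show ?thesis
    by (simp add: w_def)
qed

lemma norm_op_exp_minus_ident_le:
  fixes D :: "'b::{real_inner, banach} \<Rightarrow> 'b"
  assumes D: "bounded_linear D" and skew: "\<And>x. inner x (D x) = 0"
  shows "norm (op_exp D t x - x) \<le> \<bar>t\<bar> * norm (D x)"
proof (rule inhomogeneous_skew_evolution_bound[OF D skew])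
  interpret D: bounded_linear D by fact
  show "((\<lambda>t. op_exp D t x - x) has_vector_derivative D (op_exp D t x - x) + D x) (at t)" for t
    using has_vector_derivative_diff[OF has_vector_derivative_op_exp[OF D, of x t]
        has_vector_derivative_const[of x]]
    by (simp add: D.diff)
qed (auto simp: op_exp_0)

text \<open>
  The auxiliary vector \<open>y\<close> is a substitute for \<open>D x\<close> on which \<open>D\<close> is under control. For the Yosida approximants,
  \<open>D (D x)\<close> need not stay bounded, whereas \<open>D y\<close> does for \<open>y\<close> in the domain of the limit; such \<open>y\<close> exist
  arbitrarily close to \<open>D x\<close>.
\<close>

lemma op_exp_linearization:
  fixes D :: "'b::{real_inner, banach} \<Rightarrow> 'b"
  assumes D: "bounded_linear D" and skew: "\<And>x. inner x (D x) = 0"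
  shows "norm (op_exp D t x - x - t *\<^sub>R D x) \<le> \<bar>t\<bar> * (2 * norm (D x - y) + \<bar>t\<bar> * norm (D y))"
proof -
  let ?S = "closed_segment 0 t"
  interpret D: bounded_linear D by fact
  have diff: "op_exp D u (x - y) = op_exp D u x - op_exp D u y" for u x y
    using op_exp_add[OF D, of u "x - y" y] by (simp add: algebra_simps)
  have comm: "D (op_exp D u x) = op_exp D u (D x)" for u
    by (rule op_exp_commute[OF D D]) simp
  have "norm (op_exp D t x - op_exp D 0 x - (t - 0) *\<^sub>R D (op_exp D 0 x))
      \<le> norm (t - 0) * (2 * norm (D x - y) + \<bar>t\<bar> * norm (D y))"
  proof (rule vector_differentiable_bound_linearization[of ?S])
    show "((\<lambda>t. op_exp D t x) has_vector_derivative D (op_exp D u x)) (at u within ?S)" for u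
      using has_vector_derivative_op_exp[OF D] has_vector_derivative_at_within by blast
    show "norm (D (op_exp D u x) - D (op_exp D 0 x)) \<le> 2 * norm (D x - y) + \<bar>t\<bar> * norm (D y)"
      if "u \<in> ?S" for u
    proof -
      have u: "\<bar>u\<bar> \<le> \<bar>t\<bar>"
        using that by (auto simp: closed_segment_eq_real_ivl split: if_splits)
      have "D (op_exp D u x) - D (op_exp D 0 x)
          = op_exp D u (D x - y) - (D x - y) + (op_exp D u y - y)"
        by (simp add: comm op_exp_0 diff)
      also have "norm \<dots> \<le> norm (op_exp D u (D x - y)) + norm (D x - y) + \<bar>u\<bar> * norm (D y)"
        using norm_op_exp_minus_ident_le[OF D skew, of u y]
        by (meson add_mono norm_triangle_ineq norm_triangle_ineq4 order_trans)
      also have "\<dots> \<le> 2 * norm (D x - y) + \<bar>t\<bar> * norm (D y)"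
        using u by (simp add: norm_op_exp[OF D skew] mult_right_mono)
      finally show ?thesis .
    qed
  qed auto
  then show ?thesis
    by (simp add: op_exp_0)
qed

section \<open>Stone's theorem for operators bounded from below\<close>

text \<open>
  The part of \<open>v\<close> orthogonal to \<open>V\<close> is orthogonal to all values of \<open>f\<close>, so also to the derivative \<open>v\<close>.
\<close>

lemma derivative_in_closed_subspace:
  fixes f :: "real \<Rightarrow> 'b::{real_inner, complete_space}"
  assumes V: "closed V" "subspace V" and f: "\<And>t. f t \<in> V"
    and der: "(f has_vector_derivative v) (at t)"
  shows "v \<in> V"
proof -
  obtain y where y: "y \<in> V" "\<And>z. z \<in> V \<Longrightarrow> inner (v - y) z = 0"
    using orth_decomposition_closed_subspace[OF V] by blast
  have "((\<lambda>t. inner (v - y) (f t)) has_real_derivative inner (v - y) v) (at t)"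
    using has_real_derivative_inner[OF has_vector_derivative_const der, of "v - y"] by simp
  then have "((\<lambda>t. 0) has_real_derivative inner (v - y) v) (at t)"
    by (simp add: y(2)[OF f])
  then have "inner (v - y) v = 0"
    using DERIV_unique DERIV_const by blast
  then have "inner (v - y) (v - y) = 0"
    using y by (simp add: inner_diff_right)
  then show ?thesis
    using y(1) by simp
qed

context semibounded_selfadjoint
begin

lemma real_subspace: "subspace S"
  by (rule csubspace_imp_subspace[OF csubspace])

lemma approx_by_dom:
  assumes "\<psi> \<in> S" "0 < e"
  obtains \<phi> where "\<phi> \<in> dom H" "norm (\<psi> - \<phi>) < e"
proof -
  have "\<psi> \<in> closure (dom H)"
    using assms dense by simp
  then show thesis
    using that assms(2) unfolding closure_approachable by (metis dist_commute dist_norm)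
qed

lemma shifted_inverse_scaleR:
  assumes "0 < c + s" "\<eta> \<in> S"
  shows "shifted_inverse H s (r *\<^sub>R \<eta>) = r *\<^sub>R shifted_inverse H s \<eta>"
  using shifted_inverse_scaleC[OF assms, of "of_real r"] by (simp add: scaleC_complex_of_real)

lemma shifted_inverse_in: "0 < c + s \<Longrightarrow> \<eta> \<in> S \<Longrightarrow> shifted_inverse H s \<eta> \<in> S"
  using shifted_inverse_solves(1) dom_subset by blast

lemma shifted_inverse_commute:
  assumes s: "0 < c + s" and r: "0 < c + r" and \<eta>: "\<eta> \<in> S"
  shows "shifted_inverse H s (shifted_inverse H r \<eta>) = shifted_inverse H r (shifted_inverse H s \<eta>)"
proof -
  let ?\<phi> = "shifted_inverse H s (shifted_inverse H r \<eta>)"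
  note R = shifted_inverse_solves[OF r \<eta>]
  note Q = shifted_inverse_solves[OF s shifted_inverse_in[OF r \<eta>]]
  have h\<phi>: "h ?\<phi> = shifted_inverse H r \<eta> - s *\<^sub>R ?\<phi>"
    using Q(2) by (simp add: eq_diff_eq)
  then have d: "h ?\<phi> \<in> dom H"
    using dom_diff[OF R(1) dom_scaleR[OF Q(1)]] by simp
  have "shifted_inverse H s \<eta> = h ?\<phi> + r *\<^sub>R ?\<phi>"
  proof (rule shifted_inverse_eqI[OF s])
    show "h ?\<phi> + r *\<^sub>R ?\<phi> \<in> dom H"
      by (rule dom_add[OF d dom_scaleR[OF Q(1)]])
    have "h (h ?\<phi>) + s *\<^sub>R h ?\<phi> = h (h ?\<phi> + s *\<^sub>R ?\<phi>)"
      using h_add[OF d dom_scaleR[OF Q(1)]] h_scaleR[OF Q(1)] by simp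
    also have "\<dots> = h (shifted_inverse H r \<eta>)"
      by (simp add: Q(2))
    finally have 1: "h (h ?\<phi>) = h (shifted_inverse H r \<eta>) - s *\<^sub>R h ?\<phi>"
      by (simp add: eq_diff_eq)
    have "h (h ?\<phi> + r *\<^sub>R ?\<phi>) + s *\<^sub>R (h ?\<phi> + r *\<^sub>R ?\<phi>)
        = h (shifted_inverse H r \<eta>) + r *\<^sub>R (h ?\<phi> + s *\<^sub>R ?\<phi>)"
      unfolding h_add[OF d dom_scaleR[OF Q(1)]] h_scaleR[OF Q(1)] 1
      by (simp add: algebra_simps)
    also have "\<dots> = \<eta>"
      by (simp add: Q(2) R(2))
    finally show "h (h ?\<phi> + r *\<^sub>R ?\<phi>) + s *\<^sub>R (h ?\<phi> + r *\<^sub>R ?\<phi>) = \<eta>" .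
  qed
  then show ?thesis
    using shifted_inverse_eqI[OF r Q(1)] by metis
qed

text \<open>
  Any sequence tending to infinity would do; this one satisfies \<open>c + shift n \<ge> n + 1\<close> from the start, so
  the resolvent exists at every index.
\<close>

definition shift :: "nat \<Rightarrow> real" where
  "shift n = real n + \<bar>c\<bar> + 1"

lemma shift_ge: "real n + 1 \<le> c + shift n"
  by (simp add: shift_def)

lemma shift_pos: "0 < c + shift n"
  by (simp add: shift_def)

lemma shift_le: "shift n \<le> (1 + \<bar>c\<bar>) * (c + shift n)"
proof -
  have "shift n \<le> (1 + \<bar>c\<bar>) * (real n + 1)"
    by (simp add: shift_def algebra_simps)
  also have "\<dots> \<le> (1 + \<bar>c\<bar>) * (c + shift n)"
    by (intro mult_left_mono shift_ge) auto
  finally show ?thesis .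
qed

text \<open>
  On \<open>S\<close> this is the bounded operator \<open>s H (H + s)\<inverse> = s - s\<^sup>2 (H + s)\<inverse>\<close> for \<open>s = shift n\<close>. The projection
  extends it by zero to the whole space, so that \<^const>\<open>op_exp\<close> applies.
\<close>

definition yosida :: "nat \<Rightarrow> 'a \<Rightarrow> 'a" where
  "yosida n x = shift n *\<^sub>R orth_proj S x
     - (shift n)\<^sup>2 *\<^sub>R shifted_inverse H (shift n) (orth_proj S x)"

lemma yosida_in: "yosida n x \<in> S"
  unfolding yosida_def
  by (intro subspace_diff subspace_scale real_subspace orth_proj_in hilbert shifted_inverse_in shift_pos)

lemma yosida_add: "yosida n (x + y) = yosida n x + yosida n y"
  unfolding yosida_def orth_proj_add[OF hilbert]
    shifted_inverse_add[OF shift_pos orth_proj_in[OF hilbert] orth_proj_in[OF hilbert]]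
  by (simp add: algebra_simps)

lemma yosida_scaleC: "yosida n (k *\<^sub>C x) = k *\<^sub>C yosida n x"
  unfolding yosida_def orth_proj_scaleC[OF hilbert]
    shifted_inverse_scaleC[OF shift_pos orth_proj_in[OF hilbert]]
  by (simp add: complex_vector.scale_right_diff_distrib scaleC_scaleR)

lemma bounded_linear_yosida: "bounded_linear (yosida n)"
proof (rule bounded_linear_intro[where K = "shift n + (shift n)\<^sup>2"])
  fix x y :: 'a and r :: real
  show "yosida n (x + y) = yosida n x + yosida n y"
    by (rule yosida_add)
  show "yosida n (r *\<^sub>R x) = r *\<^sub>R yosida n x"
    using yosida_scaleC[of n "of_real r" x] by (simp add: scaleC_complex_of_real)
  let ?p = "orth_proj S x"
  have p: "?p \<in> S" "norm ?p \<le> norm x"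
    using hilbert by (auto intro: orth_proj_in norm_orth_proj_le)
  have s0: "0 \<le> shift n"
    by (simp add: shift_def)
  have "1 * norm (shifted_inverse H (shift n) ?p) \<le> (c + shift n) * norm (shifted_inverse H (shift n) ?p)"
    using shift_ge[of n] by (intro mult_right_mono) auto
  also have "\<dots> \<le> norm x"
    using norm_shifted_inverse_le[OF shift_pos p(1)] p(2) by (rule order_trans)
  finally have "norm (shifted_inverse H (shift n) ?p) \<le> norm x"
    by simp
  then have "norm (yosida n x) \<le> shift n * norm x + (shift n)\<^sup>2 * norm x"
    unfolding yosida_def using p s0
    by (intro norm_triangle_le_diff add_mono) (auto intro: mult_left_mono)
  then show "norm (yosida n x) \<le> norm x * (shift n + (shift n)\<^sup>2)"
    by (simp add: algebra_simps)
qed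

lemma yosida_symmetric: "cinner x (yosida n y) = cinner (yosida n x) y"
proof -
  have p: "orth_proj S z \<in> S" for z
    by (rule orth_proj_in[OF hilbert])
  have "cinner x (yosida n y) = cinner (orth_proj S x) (yosida n y)"
    by (simp add: cinner_orth_proj_left[OF hilbert yosida_in])
  also have "\<dots> = cinner (yosida n x) (orth_proj S y)"
    unfolding yosida_def
    by (simp add: cinner_diff_left cinner_diff_right cinner_scaleR_left cinner_scaleR_right
        shifted_inverse_symmetric[OF shift_pos p p])
  also have "\<dots> = cinner (yosida n x) y"
    by (simp add: cinner_orth_proj_right[OF hilbert yosida_in])
  finally show ?thesis .
qed

lemma yosida_commute: "yosida m (yosida n x) = yosida n (yosida m x)"
proof -
  let ?p = "orth_proj S x" and ?R = "\<lambda>n. shifted_inverse H (shift n)"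
  have p: "?p \<in> S"
    by (rule orth_proj_in[OF hilbert])
  have "yosida m (yosida n x) = (shift m * shift n) *\<^sub>R ?p - (shift m * (shift n)\<^sup>2) *\<^sub>R ?R n ?p
      - ((shift m)\<^sup>2 * shift n) *\<^sub>R ?R m ?p + ((shift m)\<^sup>2 * (shift n)\<^sup>2) *\<^sub>R ?R m (?R n ?p)" for m n
  proof -
    have R: "?R n ?p \<in> S" "shift n *\<^sub>R ?p \<in> S" "(shift n)\<^sup>2 *\<^sub>R ?R n ?p \<in> S"
      using p by (auto intro!: shifted_inverse_in shift_pos subspace_scale real_subspace)
    have "yosida m (yosida n x) = shift m *\<^sub>R yosida n x - (shift m)\<^sup>2 *\<^sub>R ?R m (yosida n x)"
      by (subst yosida_def) (simp add: orth_proj_ident[OF hilbert yosida_in])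
    also have "?R m (yosida n x) = shift n *\<^sub>R ?R m ?p - (shift n)\<^sup>2 *\<^sub>R ?R m (?R n ?p)"
      unfolding yosida_def
      by (simp add: shifted_inverse_diff[OF shift_pos R(2,3)] shifted_inverse_scaleR[OF shift_pos] p R)
    finally show ?thesis
      by (simp add: yosida_def algebra_simps)
  qed
  then show ?thesis
    using shifted_inverse_commute[OF shift_pos shift_pos p] by (simp add: mult_ac)
qed

lemma yosida_dom:
  assumes "\<psi> \<in> dom H"
  shows "yosida n \<psi> = shift n *\<^sub>R shifted_inverse H (shift n) (h \<psi>)"
proof -
  have S: "\<psi> \<in> S" "shift n *\<^sub>R \<psi> \<in> S"
    using assms dom_subset real_subspace subspace_scale by blast+
  have "\<psi> = shifted_inverse H (shift n) (h \<psi> + shift n *\<^sub>R \<psi>)"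
    by (rule shifted_inverse_eqI[OF shift_pos assms refl, symmetric])
  also have "\<dots> = shifted_inverse H (shift n) (h \<psi>) + shift n *\<^sub>R shifted_inverse H (shift n) \<psi>"
    using shifted_inverse_add[OF shift_pos h_in[OF assms] S(2)]
      shifted_inverse_scaleR[OF shift_pos S(1)] by simp
  finally have "shift n *\<^sub>R \<psi> = shift n *\<^sub>R shifted_inverse H (shift n) (h \<psi>)
      + (shift n)\<^sup>2 *\<^sub>R shifted_inverse H (shift n) \<psi>"
    by (metis power2_eq_square scaleR_add_right scaleR_scaleR)
  then show ?thesis
    by (simp add: yosida_def orth_proj_ident[OF hilbert S(1)])
qed

text \<open>
  On the domain, \<open>s (H + s)\<inverse> \<xi> - \<xi> = - (H + s)\<inverse> (H \<xi>)\<close> is of order \<open>1 / n\<close>. Density carries the convergence over to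
  \<open>S\<close> because the operators \<open>s (H + s)\<inverse>\<close> are uniformly bounded.
\<close>

lemma shift_resolvent_tendsto:
  assumes \<phi>: "\<phi> \<in> S"
  shows "(\<lambda>n. shift n *\<^sub>R shifted_inverse H (shift n) \<phi>) \<longlonglongrightarrow> \<phi>"
proof (rule LIMSEQ_I)
  fix e :: real
  assume e: "0 < e"
  let ?J = "\<lambda>n x. shift n *\<^sub>R shifted_inverse H (shift n) x"
  define d where "d = e / (2 * (2 + \<bar>c\<bar>))"
  have d: "0 < d"
    using e by (simp add: d_def)
  obtain \<xi> where \<xi>: "\<xi> \<in> dom H" "norm (\<phi> - \<xi>) < d"
    using approx_by_dom[OF \<phi> d] by blast
  have \<xi>S: "\<xi> \<in> S"
    using \<xi>(1) dom_subset by blast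
  have J_le: "norm (?J n x) \<le> (1 + \<bar>c\<bar>) * norm x" if "x \<in> S" for n x
  proof -
    have "norm (?J n x) = shift n * norm (shifted_inverse H (shift n) x)"
      by (simp add: shift_def)
    also have "\<dots> \<le> (1 + \<bar>c\<bar>) * (c + shift n) * norm (shifted_inverse H (shift n) x)"
      by (intro mult_right_mono shift_le) auto
    also have "\<dots> \<le> (1 + \<bar>c\<bar>) * norm x"
      using norm_shifted_inverse_le[OF shift_pos that]
      by (simp only: mult.assoc) (rule mult_left_mono, auto)
    finally show ?thesis .
  qed
  have J_dom: "norm (?J n \<xi> - \<xi>) \<le> norm (h \<xi>) * (1 / real (Suc n))" for n
  proof -
    have eq: "?J n \<xi> - \<xi> = - shifted_inverse H (shift n) (h \<xi>)"
    proof -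
      have "shifted_inverse H (shift n) (h \<xi> + shift n *\<^sub>R \<xi>) = \<xi>"
        by (rule shifted_inverse_eqI[OF shift_pos \<xi>(1) refl])
      moreover have "shifted_inverse H (shift n) (h \<xi> + shift n *\<^sub>R \<xi>)
          = shifted_inverse H (shift n) (h \<xi>) + ?J n \<xi>"
        using shifted_inverse_add[OF shift_pos h_in[OF \<xi>(1)]] shifted_inverse_scaleR[OF shift_pos \<xi>S]
          subspace_scale[OF real_subspace \<xi>S] by simp
      ultimately show ?thesis
        by (metis add_diff_cancel_right' minus_diff_eq)
    qed
    have "real (Suc n) * norm (shifted_inverse H (shift n) (h \<xi>))
        \<le> (c + shift n) * norm (shifted_inverse H (shift n) (h \<xi>))"
      using shift_ge[of n] by (intro mult_right_mono) auto
    also have "\<dots> \<le> norm (h \<xi>)"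
      by (rule norm_shifted_inverse_le[OF shift_pos h_in[OF \<xi>(1)]])
    finally show ?thesis
      unfolding eq norm_minus_cancel by (simp add: field_simps del: of_nat_Suc)
  qed
  have "(\<lambda>n. norm (h \<xi>) * (1 / real (Suc n))) \<longlonglongrightarrow> 0"
    using tendsto_mult_right_zero[OF LIMSEQ_inverse_real_of_nat, of "norm (h \<xi>)"]
    by (simp add: divide_inverse)
  then have "\<forall>\<^sub>F n in sequentially. norm (h \<xi>) * (1 / real (Suc n)) < e / 2"
    by (rule order_tendstoD) (use e in auto)
  then obtain N where N: "\<And>n. n \<ge> N \<Longrightarrow> norm (h \<xi>) * (1 / real (Suc n)) < e / 2"
    by (auto simp: eventually_sequentially)
  show "\<exists>N. \<forall>n\<ge>N. norm (?J n \<phi> - \<phi>) < e"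
  proof (intro exI allI impI)
    fix n
    assume n: "n \<ge> N"
    have \<phi>\<xi>: "\<phi> - \<xi> \<in> S"
      using \<phi> \<xi>S real_subspace subspace_diff by blast
    have "?J n \<phi> - \<phi> = ?J n (\<phi> - \<xi>) + (?J n \<xi> - \<xi>) - (\<phi> - \<xi>)"
      unfolding shifted_inverse_diff[OF shift_pos \<phi> \<xi>S] by (simp add: algebra_simps)
    also have "norm \<dots> \<le> norm (?J n (\<phi> - \<xi>)) + norm (?J n \<xi> - \<xi>) + norm (\<phi> - \<xi>)"
      by (meson add_right_mono norm_triangle_ineq norm_triangle_ineq4 order_trans)
    also have "\<dots> \<le> (1 + \<bar>c\<bar>) * norm (\<phi> - \<xi>) + norm (?J n \<xi> - \<xi>) + norm (\<phi> - \<xi>)"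
      using J_le[OF \<phi>\<xi>] by simp
    also have "\<dots> = (2 + \<bar>c\<bar>) * norm (\<phi> - \<xi>) + norm (?J n \<xi> - \<xi>)"
      by (simp add: algebra_simps)
    also have "\<dots> < (2 + \<bar>c\<bar>) * d + e / 2"
      using \<xi>(2) le_less_trans[OF J_dom[of n] N[OF n]]
      by (intro add_strict_mono mult_strict_left_mono) simp_all
    also have "\<dots> = e"
    proof -
      have "2 + \<bar>c\<bar> \<noteq> 0"
        using abs_ge_zero[of c] by linarith
      then show ?thesis
        unfolding d_def by (simp add: field_simps)
    qed
    finally show "norm (?J n \<phi> - \<phi>) < e" .
  qed
qed

lemma yosida_tendsto:
  assumes "\<psi> \<in> dom H"
  shows "(\<lambda>n. yosida n \<psi>) \<longlonglongrightarrow> h \<psi>"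
  using shift_resolvent_tendsto[OF h_in[OF assms]] by (simp add: yosida_dom[OF assms])

abbreviation generator :: "nat \<Rightarrow> 'a \<Rightarrow> 'a" where
  "generator n x \<equiv> \<i> *\<^sub>C yosida n x"

lemma bounded_linear_generator: "bounded_linear (generator n)"
  by (rule bounded_linear_compose[OF bounded_linear_scaleC bounded_linear_yosida])

lemma generator_skew: "inner x (generator n x) = 0"
proof -
  have "cinner x (yosida n x) = cnj (cinner x (yosida n x))"
    using cinner_commute[of x "yosida n x"] yosida_symmetric[of x n x] by simp
  then have "Im (cinner x (yosida n x)) = 0"
    by (simp add: complex_eq_iff)
  then show ?thesis
    using Im_cinner[of x "yosida n x"] by simp
qed

lemma generator_commute: "generator m (generator n x) = generator n (generator m x)"
  by (simp add: yosida_scaleC yosida_commute[of m n])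

definition evol :: "nat \<Rightarrow> real \<Rightarrow> 'a \<Rightarrow> 'a" where
  "evol n = op_exp (generator n)"

lemmas norm_evol = norm_op_exp[OF bounded_linear_generator generator_skew, folded evol_def]
lemmas evol_add = op_exp_add[OF bounded_linear_generator, folded evol_def]
lemmas evol_group = op_exp_group[OF bounded_linear_generator generator_skew, folded evol_def]
lemmas has_vector_derivative_evol =
  has_vector_derivative_op_exp[OF bounded_linear_generator, folded evol_def]
lemmas norm_evol_minus_ident_le =
  norm_op_exp_minus_ident_le[OF bounded_linear_generator generator_skew, folded evol_def]
lemmas evol_linearization =
  op_exp_linearization[OF bounded_linear_generator generator_skew, folded evol_def]

lemma evol_0: "evol n 0 x = x"
  by (simp add: evol_def op_exp_0)

lemma evol_diff: "evol n t (x - y) = evol n t x - evol n t y"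
  using evol_add[of n t "x - y" y] by (simp add: algebra_simps)

lemma evol_scaleC: "evol n t (k *\<^sub>C x) = k *\<^sub>C evol n t x"
  unfolding evol_def
  by (rule op_exp_commute[OF bounded_linear_generator bounded_linear_scaleC, symmetric])
    (simp add: yosida_scaleC scaleC_scaleC mult.commute)

lemma evol_in: "x \<in> S \<Longrightarrow> evol n t x \<in> S"
  unfolding evol_def
  by (rule op_exp_in_closed_subspace[OF bounded_linear_generator closed real_subspace])
    (use csubspace yosida_in in \<open>auto intro: complex_vector.subspace_scale\<close>)

text \<open>
  The difference solves the evolution equation of \<open>generator n\<close> with an inhomogeneity whose norm is constant in time,
  because the approximants commute with each other and with their isometric evolutions.
\<close>

lemma norm_evol_diff_le:
  "norm (evol n t x - evol m t x) \<le> \<bar>t\<bar> * norm (yosida n x - yosida m x)"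
proof (rule inhomogeneous_skew_evolution_bound[OF bounded_linear_generator generator_skew])
  interpret D: bounded_linear "generator n" for n
    by (rule bounded_linear_generator)
  let ?g = "\<lambda>t. generator n (evol m t x) - generator m (evol m t x)"
  show "((\<lambda>t. evol n t x - evol m t x) has_vector_derivative
      generator n (evol n t x - evol m t x) + ?g t) (at t)" for t
    using has_vector_derivative_diff[OF has_vector_derivative_evol[of n x t]
        has_vector_derivative_evol[of m x t]]
    by (simp only: D.diff) simp
  show "norm (?g t) \<le> norm (yosida n x - yosida m x)" for t
  proof -
    have "?g t = evol m t (generator n x - generator m x)"
      unfolding evol_def
      by (rule op_exp_commute[OF bounded_linear_generator
            bounded_linear_sub[OF bounded_linear_generator bounded_linear_generator]])
        (simp add: D.diff generator_commute[of n m])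
    also have "norm \<dots> = norm (\<i> *\<^sub>C (yosida n x - yosida m x))"
      by (simp add: norm_evol complex_vector.scale_right_diff_distrib)
    finally show ?thesis
      by (simp add: norm_scaleC)
  qed
qed (simp add: evol_0)

lemma evol_convergent:
  assumes \<psi>: "\<psi> \<in> S"
  shows "convergent (\<lambda>n. evol n t \<psi>)"
proof (rule Cauchy_convergent, rule CauchyI)
  fix e :: real
  assume e: "0 < e"
  obtain \<phi> where \<phi>: "\<phi> \<in> dom H" "norm (\<psi> - \<phi>) < e / 4"
    using approx_by_dom[OF \<psi>, of "e / 4"] e by auto
  have "Cauchy (\<lambda>n. \<bar>t\<bar> *\<^sub>R yosida n \<phi>)"
    by (rule LIMSEQ_imp_Cauchy[OF tendsto_scaleR[OF tendsto_const yosida_tendsto[OF \<phi>(1)]]])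
  then obtain M where M: "\<And>m n. m \<ge> M \<Longrightarrow> n \<ge> M \<Longrightarrow>
      norm (\<bar>t\<bar> *\<^sub>R yosida m \<phi> - \<bar>t\<bar> *\<^sub>R yosida n \<phi>) < e / 2"
    using CauchyD[of _ "e / 2"] e by (metis half_gt_zero)
  show "\<exists>M. \<forall>m\<ge>M. \<forall>n\<ge>M. norm (evol m t \<psi> - evol n t \<psi>) < e"
  proof (intro exI allI impI)
    fix m n
    assume mn: "m \<ge> M" "n \<ge> M"
    have "norm (\<bar>t\<bar> *\<^sub>R yosida m \<phi> - \<bar>t\<bar> *\<^sub>R yosida n \<phi>) = \<bar>t\<bar> * norm (yosida m \<phi> - yosida n \<phi>)"
      by (simp flip: scaleR_diff_right)
    then have 1: "norm (evol m t \<phi> - evol n t \<phi>) < e / 2"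
      using M[OF mn] norm_evol_diff_le[of m t \<phi> n] by linarith
    have "evol m t \<psi> - evol n t \<psi> = evol m t (\<psi> - \<phi>) + (evol m t \<phi> - evol n t \<phi>) - evol n t (\<psi> - \<phi>)"
      by (simp add: evol_diff)
    also have "norm \<dots> \<le> norm (evol m t (\<psi> - \<phi>)) + norm (evol m t \<phi> - evol n t \<phi>)
        + norm (evol n t (\<psi> - \<phi>))"
      by (meson add_right_mono norm_triangle_ineq norm_triangle_ineq4 order_trans)
    also have "\<dots> < e"
      using 1 \<phi>(2) by (simp add: norm_evol)
    finally show "norm (evol m t \<psi> - evol n t \<psi>) < e" .
  qed
qed

text \<open>
  The group \<open>exp (\<i> t H)\<close> on \<open>S\<close>.
\<close>

definition group :: "real \<Rightarrow> 'a \<Rightarrow> 'a" where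
  "group t \<psi> = lim (\<lambda>n. evol n t \<psi>)"

lemma evol_tendsto: "\<psi> \<in> S \<Longrightarrow> (\<lambda>n. evol n t \<psi>) \<longlonglongrightarrow> group t \<psi>"
  unfolding group_def using evol_convergent convergent_LIMSEQ_iff by blast

lemma group_in: "\<psi> \<in> S \<Longrightarrow> group t \<psi> \<in> S"
  using closed_sequentially[OF closed _ evol_tendsto] evol_in by blast

lemma norm_group: "\<psi> \<in> S \<Longrightarrow> norm (group t \<psi>) = norm \<psi>"
  using tendsto_norm[OF evol_tendsto, of \<psi> t] by (simp add: norm_evol LIMSEQ_const_iff)

lemma group_0: "group 0 \<psi> = \<psi>"
  by (simp add: group_def evol_0 limI)

lemma group_add:
  assumes "\<phi> \<in> S" "\<psi> \<in> S"
  shows "group t (\<phi> + \<psi>) = group t \<phi> + group t \<psi>"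
proof (rule LIMSEQ_unique)
  show "(\<lambda>n. evol n t (\<phi> + \<psi>)) \<longlonglongrightarrow> group t (\<phi> + \<psi>)"
    using assms real_subspace by (intro evol_tendsto subspace_add)
  show "(\<lambda>n. evol n t (\<phi> + \<psi>)) \<longlonglongrightarrow> group t \<phi> + group t \<psi>"
    unfolding evol_add using assms by (intro tendsto_intros evol_tendsto)
qed

lemma group_scaleC:
  assumes "\<psi> \<in> S"
  shows "group t (k *\<^sub>C \<psi>) = k *\<^sub>C group t \<psi>"
proof (rule LIMSEQ_unique)
  show "(\<lambda>n. evol n t (k *\<^sub>C \<psi>)) \<longlonglongrightarrow> group t (k *\<^sub>C \<psi>)"
    using assms csubspace by (intro evol_tendsto) (simp add: complex_vector.subspace_scale)
  show "(\<lambda>n. evol n t (k *\<^sub>C \<psi>)) \<longlonglongrightarrow> k *\<^sub>C group t \<psi>"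
    unfolding evol_scaleC using assms by (intro tendsto_scaleC evol_tendsto)
qed

lemma group_diff:
  assumes "\<phi> \<in> S" "\<psi> \<in> S"
  shows "group t (\<phi> - \<psi>) = group t \<phi> - group t \<psi>"
  using group_add[of "\<phi> - \<psi>" \<psi> t] assms real_subspace by (simp add: subspace_diff algebra_simps)

lemma group_group:
  assumes "\<psi> \<in> S"
  shows "group (s + t) \<psi> = group s (group t \<psi>)"
proof (rule LIMSEQ_unique[OF evol_tendsto[OF assms]])
  have "(\<lambda>n. evol n s (evol n t \<psi> - group t \<psi>)) \<longlonglongrightarrow> 0"
  proof (rule tendsto_norm_zero_cancel)
    have "(\<lambda>n. evol n t \<psi> - group t \<psi>) \<longlonglongrightarrow> 0"
      using evol_tendsto[OF assms] by (rule LIM_zero)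
    then show "(\<lambda>n. norm (evol n s (evol n t \<psi> - group t \<psi>))) \<longlonglongrightarrow> 0"
      unfolding norm_evol by (rule tendsto_norm_zero)
  qed
  from tendsto_add[OF this evol_tendsto[OF group_in[OF assms], of s t]]
  show "(\<lambda>n. evol n (s + t) \<psi>) \<longlonglongrightarrow> group s (group t \<psi>)"
    by (simp add: evol_diff evol_group)
qed

lemma norm_group_minus_ident_le:
  assumes "\<phi> \<in> dom H"
  shows "norm (group t \<phi> - \<phi>) \<le> \<bar>t\<bar> * norm (h \<phi>)"
proof (rule LIMSEQ_le)
  have S: "\<phi> \<in> S"
    using assms dom_subset by blast
  show "(\<lambda>n. norm (evol n t \<phi> - \<phi>)) \<longlonglongrightarrow> norm (group t \<phi> - \<phi>)"
    by (intro tendsto_intros evol_tendsto S)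
  show "(\<lambda>n. \<bar>t\<bar> * norm (yosida n \<phi>)) \<longlonglongrightarrow> \<bar>t\<bar> * norm (h \<phi>)"
    by (intro tendsto_intros yosida_tendsto assms)
  show "\<exists>N. \<forall>n\<ge>N. norm (evol n t \<phi> - \<phi>) \<le> \<bar>t\<bar> * norm (yosida n \<phi>)"
    using norm_evol_minus_ident_le[of _ t \<phi>] by (simp add: norm_scaleC)
qed

lemma continuous_group:
  assumes \<psi>: "\<psi> \<in> S"
  shows "continuous_on UNIV (\<lambda>t. group t \<psi>)"
  unfolding continuous_on_iff
proof (intro ballI allI impI)
  fix t e :: real
  assume e: "0 < e"
  obtain \<phi> where \<phi>: "\<phi> \<in> dom H" "norm (\<psi> - \<phi>) < e / 4"
    using approx_by_dom[OF \<psi>, of "e / 4"] e by auto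
  have \<phi>S: "\<phi> \<in> S"
    using \<phi>(1) dom_subset by blast
  define N where "N = norm (h \<phi>) + 1"
  define d where "d = e / (2 * N)"
  have N: "0 < N" "norm (h \<phi>) \<le> N"
    by (simp_all add: N_def add_nonneg_pos)
  then have d: "0 < d"
    using e by (simp add: d_def)
  show "\<exists>d>0. \<forall>t'\<in>UNIV. dist t' t < d \<longrightarrow> dist (group t' \<psi>) (group t \<psi>) < e"
  proof (intro exI conjI ballI impI, rule d)
    fix t'
    assume t': "dist t' t < d"
    let ?u = "t' - t"
    have "group t' \<psi> = group t (group ?u \<psi>)"
      using group_group[OF \<psi>, of t ?u] by simp
    then have "group t' \<psi> - group t \<psi> = group t (group ?u \<psi> - \<psi>)"
      using group_diff[OF group_in[OF \<psi>] \<psi>] by simp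
    then have "dist (group t' \<psi>) (group t \<psi>) = norm (group ?u \<psi> - \<psi>)"
      using norm_group \<psi> group_in[OF \<psi>] real_subspace by (simp add: dist_norm subspace_diff)
    also have "group ?u \<psi> - \<psi> = group ?u (\<psi> - \<phi>) + (group ?u \<phi> - \<phi>) - (\<psi> - \<phi>)"
      using group_diff[OF \<psi> \<phi>S] by simp
    also have "norm \<dots> \<le> norm (group ?u (\<psi> - \<phi>)) + norm (group ?u \<phi> - \<phi>) + norm (\<psi> - \<phi>)"
      by (meson add_right_mono norm_triangle_ineq norm_triangle_ineq4 order_trans)
    also have "\<dots> \<le> norm (\<psi> - \<phi>) + \<bar>?u\<bar> * norm (h \<phi>) + norm (\<psi> - \<phi>)"
      using norm_group[of "\<psi> - \<phi>" ?u] norm_group_minus_ident_le[OF \<phi>(1), of ?u] \<psi> \<phi>S real_subspace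
      by (simp add: subspace_diff)
    also have "\<bar>?u\<bar> * norm (h \<phi>) \<le> d * N"
      using t' d N by (intro mult_mono) (auto simp: dist_real_def)
    also have "d * N = e / 2"
      using N by (simp add: d_def)
    finally show "dist (group t' \<psi>) (group t \<psi>) < e"
      using \<phi>(2) by simp
  qed
qed

text \<open>
  The first-order remainder is estimated through an element \<open>\<phi>\<close> of the domain close to \<open>H \<psi>\<close>, since \<open>H \<psi>\<close> itself may lie
  outside the domain.
\<close>

lemma group_has_derivative:
  assumes \<psi>: "\<psi> \<in> dom H"
  shows "((\<lambda>t. group t \<psi>) has_vector_derivative \<i> *\<^sub>C h \<psi>) (at 0)"
proof -
  have \<psi>S: "\<psi> \<in> S"
    using \<psi> dom_subset by blast
  have est: "norm (group t \<psi> - \<psi> - t *\<^sub>R (\<i> *\<^sub>C h \<psi>)) \<le> \<bar>t\<bar> * (2 * norm (h \<psi> - \<phi>) + \<bar>t\<bar> * norm (h \<phi>))"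
    if \<phi>: "\<phi> \<in> dom H" for t \<phi>
  proof (rule LIMSEQ_le)
    show "(\<lambda>n. norm (evol n t \<psi> - \<psi> - t *\<^sub>R generator n \<psi>))
        \<longlonglongrightarrow> norm (group t \<psi> - \<psi> - t *\<^sub>R (\<i> *\<^sub>C h \<psi>))"
      by (intro tendsto_intros tendsto_scaleC evol_tendsto yosida_tendsto \<psi> \<psi>S)
    show "(\<lambda>n. \<bar>t\<bar> * (2 * norm (yosida n \<psi> - \<phi>) + \<bar>t\<bar> * norm (yosida n \<phi>)))
        \<longlonglongrightarrow> \<bar>t\<bar> * (2 * norm (h \<psi> - \<phi>) + \<bar>t\<bar> * norm (h \<phi>))"
      by (intro tendsto_intros yosida_tendsto \<psi> \<phi>)
    have "norm (evol n t \<psi> - \<psi> - t *\<^sub>R generator n \<psi>)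
        \<le> \<bar>t\<bar> * (2 * norm (yosida n \<psi> - \<phi>) + \<bar>t\<bar> * norm (yosida n \<phi>))" for n
    proof -
      have "norm (generator n \<psi> - \<i> *\<^sub>C \<phi>) = norm (yosida n \<psi> - \<phi>)"
        using norm_scaleC[of \<i> "yosida n \<psi> - \<phi>"] by (simp add: complex_vector.scale_right_diff_distrib)
      moreover have "norm (generator n (\<i> *\<^sub>C \<phi>)) = norm (yosida n \<phi>)"
        by (simp add: yosida_scaleC norm_scaleC)
      ultimately show ?thesis
        using evol_linearization[of n t \<psi> "\<i> *\<^sub>C \<phi>"] by simp
    qed
    then show "\<exists>N. \<forall>n\<ge>N. norm (evol n t \<psi> - \<psi> - t *\<^sub>R generator n \<psi>)
        \<le> \<bar>t\<bar> * (2 * norm (yosida n \<psi> - \<phi>) + \<bar>t\<bar> * norm (yosida n \<phi>))"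
      by blast
  qed
  show ?thesis
    unfolding has_vector_derivative_def has_derivative_at_alt
  proof (intro conjI allI impI)
    show "bounded_linear (\<lambda>t. t *\<^sub>R (\<i> *\<^sub>C h \<psi>))"
      by (rule bounded_linear_scaleR_left)
    fix e :: real
    assume e: "0 < e"
    obtain \<phi> where \<phi>: "\<phi> \<in> dom H" "norm (h \<psi> - \<phi>) < e / 4"
      using approx_by_dom[OF h_in[OF \<psi>], of "e / 4"] e by auto
    define N where "N = norm (h \<phi>) + 1"
    define d where "d = e / (2 * N)"
    have N: "0 < N" "norm (h \<phi>) \<le> N"
      by (simp_all add: N_def add_nonneg_pos)
    then have d: "0 < d"
      using e by (simp add: d_def)
    show "\<exists>d>0. \<forall>t. norm (t - 0) < d \<longrightarrow>
        norm (group t \<psi> - group 0 \<psi> - (t - 0) *\<^sub>R (\<i> *\<^sub>C h \<psi>)) \<le> e * norm (t - 0)"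
    proof (intro exI conjI allI impI, rule d)
      fix t :: real
      assume t: "norm (t - 0) < d"
      have "\<bar>t\<bar> * norm (h \<phi>) \<le> d * N"
        using t d N by (intro mult_mono) auto
      also have "\<dots> = e / 2"
        using N by (simp add: d_def)
      finally have "2 * norm (h \<psi> - \<phi>) + \<bar>t\<bar> * norm (h \<phi>) \<le> e"
        using \<phi>(2) by linarith
      then have "\<bar>t\<bar> * (2 * norm (h \<psi> - \<phi>) + \<bar>t\<bar> * norm (h \<phi>)) \<le> \<bar>t\<bar> * e"
        by (intro mult_left_mono) auto
      then show "norm (group t \<psi> - group 0 \<psi> - (t - 0) *\<^sub>R (\<i> *\<^sub>C h \<psi>)) \<le> e * norm (t - 0)"
        using est[OF \<phi>(1), of t] by (simp add: group_0 mult.commute)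
    qed
  qed
qed

lemma inner_group:
  assumes "\<phi> \<in> S" "\<psi> \<in> S"
  shows "inner (group t \<phi>) (group t \<psi>) = inner \<phi> \<psi>"
  using norm_group[of "\<phi> + \<psi>" t] norm_group[OF assms(1), of t] norm_group[OF assms(2), of t]
    group_add[OF assms, of t] subspace_add[OF real_subspace assms]
  by (simp add: dot_norm)

lemma cinner_group:
  assumes "\<phi> \<in> S" "\<psi> \<in> S"
  shows "cinner (group t \<phi>) (group t \<psi>) = cinner \<phi> \<psi>"
proof -
  have "\<i> *\<^sub>C \<psi> \<in> S"
    using assms(2) csubspace by (simp add: complex_vector.subspace_scale)
  from inner_group[OF assms(1) this, of t] inner_group[OF assms, of t] show ?thesis
    by (simp add: complex_eq_iff Re_cinner Im_cinner group_scaleC[OF assms(2)])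
qed

text \<open>
  Differentiating the constant \<open>\<langle>exp (\<i> t H) \<xi>|exp (\<i> t H) \<psi>\<rangle>\<close> at \<open>0\<close> for \<open>\<xi>\<close> in the domain shows that \<open>H\<close> acts on \<open>\<psi>\<close> weakly
  as \<open>\<phi>\<close>, and self-adjointness makes this an equality.
\<close>

lemma H_eq_if_group_has_derivative:
  assumes \<psi>: "\<psi> \<in> S" and der: "((\<lambda>t. group t \<psi>) has_vector_derivative \<i> *\<^sub>C \<phi>) (at 0)"
  shows "H \<psi> = Some \<phi>"
proof -
  have real_sym: "inner \<xi> \<phi> = inner (h \<xi>) \<psi>" if \<xi>: "\<xi> \<in> dom H" for \<xi>
  proof -
    (* Testing with i xi turns the derivatives i (H xi) and i phi into inner products without i. *)
    have \<i>\<xi>: "\<i> *\<^sub>C \<xi> \<in> dom H" "\<i> *\<^sub>C \<xi> \<in> S"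
      using dom_scaleC[OF \<xi>] dom_subset by auto
    from has_real_derivative_inner[OF group_has_derivative[OF \<i>\<xi>(1)] der]
    have "((\<lambda>t. inner (\<i> *\<^sub>C \<xi>) \<psi>) has_real_derivative
        inner (\<i> *\<^sub>C h (\<i> *\<^sub>C \<xi>)) \<psi> + inner (\<i> *\<^sub>C \<xi>) (\<i> *\<^sub>C \<phi>)) (at 0)"
      by (simp add: inner_group[OF \<i>\<xi>(2) \<psi>] group_0)
    then have "inner (\<i> *\<^sub>C h (\<i> *\<^sub>C \<xi>)) \<psi> + inner (\<i> *\<^sub>C \<xi>) (\<i> *\<^sub>C \<phi>) = 0"
      using DERIV_unique DERIV_const by blast
    moreover have "inner (\<i> *\<^sub>C \<xi>) (\<i> *\<^sub>C \<phi>) = inner \<xi> \<phi>"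
      by (simp add: cinner_scaleC_left cinner_scaleC_right flip: Re_cinner)
    moreover have "\<i> *\<^sub>C h (\<i> *\<^sub>C \<xi>) = - h \<xi>"
      using h_scaleC[OF \<xi>, of \<i>] by (simp add: scaleC_scaleC)
    ultimately show ?thesis
      by simp
  qed
  have \<phi>S: "\<phi> \<in> S"
  proof -
    have "\<i> *\<^sub>C \<phi> \<in> S"
      by (rule derivative_in_closed_subspace[OF closed real_subspace group_in[OF \<psi>] der])
    then have "(- \<i>) *\<^sub>C \<i> *\<^sub>C \<phi> \<in> S"
      using csubspace by (blast intro: complex_vector.subspace_scale)
    then show ?thesis
      by (simp add: scaleC_scaleC)
  qed
  show ?thesis
  proof (rule H_eqI[OF \<psi> \<phi>S])
    fix \<xi>
    assume \<xi>: "\<xi> \<in> dom H"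
    have "inner (\<i> *\<^sub>C \<xi>) \<phi> = inner (\<i> *\<^sub>C h \<xi>) \<psi>"
      using real_sym[OF dom_scaleC[OF \<xi>, of \<i>]] h_scaleC[OF \<xi>] by simp
    then have "cinner \<xi> \<phi> = cinner (h \<xi>) \<psi>"
      using real_sym[OF \<xi>] by (simp add: complex_eq_iff cinner_scaleC_left flip: Re_cinner)
    then show "cinner \<psi> (h \<xi>) = cinner \<phi> \<xi>"
      by (metis cinner_commute)
  qed
qed

lemma unitary_group_of_group: "unitary_group_of H (\<lambda>t. restrict (group t) S)"
  unfolding unitary_group_of_def hspace_eq
proof (intro conjI allI ballI)
  show "restrict (group t) S \<in> S \<rightarrow>\<^sub>E S" for t
    using group_in by auto
  show "restrict (group t) S ` S = S" for t
  proof
    show "restrict (group t) S ` S \<subseteq> S"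
      using group_in by auto
    show "S \<subseteq> restrict (group t) S ` S"
    proof
      fix x
      assume x: "x \<in> S"
      have "group t (group (- t) x) = x"
        using group_group[OF x, of t "- t"] by (simp add: group_0)
      then show "x \<in> restrict (group t) S ` S"
        using group_in[OF x, of "- t"] by (intro image_eqI[of _ _ "group (- t) x"]) auto
    qed
  qed
next
  fix \<psi> \<phi>
  assume \<psi>: "\<psi> \<in> S"
  show "(H \<psi> = Some \<phi>) = ((\<lambda>t. restrict (group t) S \<psi>) has_vector_derivative \<i> *\<^sub>C \<phi>) (at 0)"
  proof
    assume H: "H \<psi> = Some \<phi>"
    then have "\<psi> \<in> dom H"
      by blast
    from group_has_derivative[OF this]
    show "((\<lambda>t. restrict (group t) S \<psi>) has_vector_derivative \<i> *\<^sub>C \<phi>) (at 0)"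
      using H \<psi> by simp
  next
    assume "((\<lambda>t. restrict (group t) S \<psi>) has_vector_derivative \<i> *\<^sub>C \<phi>) (at 0)"
    then show "H \<psi> = Some \<phi>"
      using \<psi> by (intro H_eq_if_group_has_derivative) simp_all
  qed
next
  fix s t \<psi>
  assume \<psi>: "\<psi> \<in> S"
  show "restrict (group (s + t)) S \<psi> = restrict (group s) S (restrict (group t) S \<psi>)"
    using \<psi> group_in[OF \<psi>, of t] group_group[OF \<psi>, of s t] by simp
next
  fix t k \<psi>
  assume \<psi>: "\<psi> \<in> S"
  then have "k *\<^sub>C \<psi> \<in> S"
    using csubspace by (simp add: complex_vector.subspace_scale)
  then show "restrict (group t) S (k *\<^sub>C \<psi>) = k *\<^sub>C restrict (group t) S \<psi>"
    using \<psi> group_scaleC[OF \<psi>, of t k] by simp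
next
  fix t \<phi> \<psi>
  assume S: "\<phi> \<in> S" "\<psi> \<in> S"
  then have "\<phi> + \<psi> \<in> S"
    using real_subspace by (simp add: subspace_add)
  then show "restrict (group t) S (\<phi> + \<psi>) = restrict (group t) S \<phi> + restrict (group t) S \<psi>"
    using S group_add[OF S, of t] by simp
  show "cinner (restrict (group t) S \<phi>) (restrict (group t) S \<psi>) = cinner \<phi> \<psi>"
    using S cinner_group[OF S, of t] by simp
next
  fix \<psi>
  assume \<psi>: "\<psi> \<in> S"
  show "restrict (group 0) S \<psi> = \<psi>"
    using \<psi> group_0 by simp
  show "continuous_on UNIV (\<lambda>t. restrict (group t) S \<psi>)"
    using \<psi> continuous_group[OF \<psi>] by simp
qed

lemma unitary_group_ofD:
  assumes "unitary_group_of H W"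
  shows "W t \<in> S \<rightarrow>\<^sub>E S"
    and "\<phi> \<in> S \<Longrightarrow> \<psi> \<in> S \<Longrightarrow> W t (\<phi> + \<psi>) = W t \<phi> + W t \<psi>"
    and "\<psi> \<in> S \<Longrightarrow> W t (k *\<^sub>C \<psi>) = k *\<^sub>C W t \<psi>"
    and "\<phi> \<in> S \<Longrightarrow> \<psi> \<in> S \<Longrightarrow> cinner (W t \<phi>) (W t \<psi>) = cinner \<phi> \<psi>"
    and "\<psi> \<in> S \<Longrightarrow> W 0 \<psi> = \<psi>"
    and "\<psi> \<in> S \<Longrightarrow> W (s + t) \<psi> = W s (W t \<psi>)"
    and "\<psi> \<in> S \<Longrightarrow> H \<psi> = Some \<zeta> \<longleftrightarrow>
      ((\<lambda>t. W t \<psi>) has_vector_derivative \<i> *\<^sub>C \<zeta>) (at 0)"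
  using assms unfolding unitary_group_of_def hspace_eq by blast+

lemma unitary_group_of_in: "unitary_group_of H W \<Longrightarrow> \<psi> \<in> S \<Longrightarrow> W t \<psi> \<in> S"
  using unitary_group_ofD(1) by (rule PiE_mem)

lemma norm_unitary_group:
  assumes "unitary_group_of H W" "\<psi> \<in> S"
  shows "norm (W t \<psi>) = norm \<psi>"
  using unitary_group_ofD(4)[OF assms assms(2), of t]
  unfolding cinner_self of_real_eq_iff by (simp only: power2_eq_iff_nonneg norm_ge_zero)

lemma bounded_linear_unitary_group:
  assumes W: "unitary_group_of H W"
  shows "bounded_linear (\<lambda>x. W t (orth_proj S x))"
proof (rule bounded_linear_intro[where K = 1])
  have p: "orth_proj S x \<in> S" for x
    by (rule orth_proj_in[OF hilbert])
  show "W t (orth_proj S (x + y)) = W t (orth_proj S x) + W t (orth_proj S y)" for x y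
    by (simp add: orth_proj_add[OF hilbert] unitary_group_ofD(2)[OF W p p])
  show "W t (orth_proj S (r *\<^sub>R x)) = r *\<^sub>R W t (orth_proj S x)" for r x
    using unitary_group_ofD(3)[OF W p, of t "of_real r" x]
      orth_proj_scaleC[OF hilbert, of "of_real r" x]
    by (simp add: scaleC_complex_of_real)
  show "norm (W t (orth_proj S x)) \<le> norm x * 1" for x
    by (simp add: norm_unitary_group[OF W p] norm_orth_proj_le[OF hilbert])
qed

text \<open>
  A group with generator \<open>H\<close> maps the domain into itself, so on the domain its orbits solve \<open>\<psi>' = \<i> H \<psi>\<close> at all times. The
  difference of two solutions has constant norm because \<open>H\<close> is symmetric. Density then gives equality on \<open>S\<close>, and
  outside \<open>S\<close> both groups take the default value.
\<close>

lemma unitary_group_of_unique: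
  assumes U: "unitary_group_of H U" and V: "unitary_group_of H V"
  shows "U = V"
proof -
  have diff_W: "W t (\<phi> - \<psi>) = W t \<phi> - W t \<psi>"
    if W: "unitary_group_of H W" and "\<phi> \<in> S" "\<psi> \<in> S" for W t \<phi> \<psi>
    using unitary_group_ofD(2)[OF W, of "\<phi> - \<psi>" \<psi> t] that real_subspace by (simp add: subspace_diff algebra_simps)
  have deriv_W: "W t \<psi> \<in> dom H \<and> ((\<lambda>t. W t \<psi>) has_vector_derivative \<i> *\<^sub>C h (W t \<psi>)) (at t)"
    if W: "unitary_group_of H W" and \<psi>: "\<psi> \<in> dom H" for W t \<psi>
  proof -
    have \<psi>S: "\<psi> \<in> S"
      using \<psi> dom_subset by blast
    define P where "P = (\<lambda>x. W t (orth_proj S x))"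
    have P: "bounded_linear P"
      unfolding P_def by (rule bounded_linear_unitary_group[OF W])
    have P_eq: "P x = W t x" if "x \<in> S" for x
      by (simp add: P_def orth_proj_ident[OF hilbert that])
    have "((\<lambda>s. W s \<psi>) has_vector_derivative \<i> *\<^sub>C h \<psi>) (at 0)"
      using \<psi> by (subst unitary_group_ofD(7)[OF W \<psi>S, symmetric]) auto
    from bounded_linear.has_vector_derivative[OF P this]
    have "((\<lambda>s. W (t + s) \<psi>) has_vector_derivative P (\<i> *\<^sub>C h \<psi>)) (at 0)"
      by (simp add: P_eq unitary_group_of_in[OF W \<psi>S] unitary_group_ofD(6)[OF W \<psi>S])
    moreover have "P (\<i> *\<^sub>C h \<psi>) = \<i> *\<^sub>C W t (h \<psi>)"
    proof -
      have "\<i> *\<^sub>C h \<psi> \<in> S"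
        using h_in[OF \<psi>] csubspace by (simp add: complex_vector.subspace_scale)
      then show ?thesis
        using unitary_group_ofD(3)[OF W h_in[OF \<psi>]] by (simp add: P_eq)
    qed
    ultimately have d0: "((\<lambda>s. W (t + s) \<psi>) has_vector_derivative \<i> *\<^sub>C W t (h \<psi>)) (at 0)"
      by simp
    have "W (t + s) \<psi> = W s (W t \<psi>)" for s
      using unitary_group_ofD(6)[OF W \<psi>S, of s t] by (simp add: add.commute)
    then have H: "H (W t \<psi>) = Some (W t (h \<psi>))"
      using d0 unitary_group_ofD(7)[OF W unitary_group_of_in[OF W \<psi>S]] by simp
    have "((\<lambda>s. s - t) has_vector_derivative 1) (at t)"
      by (auto intro!: derivative_eq_intros)
    from vector_diff_chain_at[OF this, of "\<lambda>s. W (t + s) \<psi>"] d0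
    have "((\<lambda>s. W s \<psi>) has_vector_derivative \<i> *\<^sub>C W t (h \<psi>)) (at t)"
      by (simp add: o_def)
    then show ?thesis
      using H by auto
  qed
  have "U t \<psi> = V t \<psi>" if \<psi>: "\<psi> \<in> dom H" for t \<psi>
  proof -
    define w where "w t = U t \<psi> - V t \<psi>" for t
    have \<psi>S: "\<psi> \<in> S"
      using \<psi> dom_subset by blast
    have w: "w t \<in> dom H" "(w has_vector_derivative \<i> *\<^sub>C h (w t)) (at t)" for t
    proof -
      note u = deriv_W[OF U \<psi>, of t] and v = deriv_W[OF V \<psi>, of t]
      show "w t \<in> dom H"
        using u v by (simp only: w_def) (intro dom_diff, blast+)
      have "\<i> *\<^sub>C h (w t) = \<i> *\<^sub>C h (U t \<psi>) - \<i> *\<^sub>C h (V t \<psi>)"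
        using u v by (simp add: w_def h_diff complex_vector.scale_right_diff_distrib)
      then show "(w has_vector_derivative \<i> *\<^sub>C h (w t)) (at t)"
        using u v unfolding w_def[abs_def] by (simp add: has_vector_derivative_diff)
    qed
    have "inner (w t) (\<i> *\<^sub>C h (w t)) = 0" for t
    proof -
      have "cinner (w t) (h (w t)) = cnj (cinner (w t) (h (w t)))"
        using symmetric[OF w(1) w(1), of t t] cinner_commute[of "w t" "h (w t)"] by simp
      then have "Im (cinner (w t) (h (w t))) = 0"
        by (simp add: complex_eq_iff)
      then show ?thesis
        using Im_cinner[of "w t" "h (w t)"] by simp
    qed
    then have "norm (w t) = norm (w 0)"
      using norm_const_if_orthogonal_derivative[OF w(2)] by blast
    then show ?thesis
      using unitary_group_ofD(5)[OF U \<psi>S] unitary_group_ofD(5)[OF V \<psi>S] by (simp add: w_def)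
  qed
  note on_dom = this
  have on_S: "U t \<psi> = V t \<psi>" if \<psi>: "\<psi> \<in> S" for t \<psi>
  proof (rule ccontr)
    assume "\<not> ?thesis"
    then have e: "0 < norm (U t \<psi> - V t \<psi>) / 2"
      by simp
    obtain \<phi> where \<phi>: "\<phi> \<in> dom H" "norm (\<psi> - \<phi>) < norm (U t \<psi> - V t \<psi>) / 2"
      using approx_by_dom[OF \<psi> e] by blast
    have \<phi>S: "\<phi> \<in> S" "\<psi> - \<phi> \<in> S"
      using \<phi>(1) \<psi> dom_subset real_subspace by (auto intro: subspace_diff)
    have "U t \<psi> - V t \<psi> = U t (\<psi> - \<phi>) - V t (\<psi> - \<phi>)"
      using diff_W[OF U \<psi> \<phi>S(1)] diff_W[OF V \<psi> \<phi>S(1)] on_dom[OF \<phi>(1)] by simp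
    then have "norm (U t \<psi> - V t \<psi>) \<le> norm (\<psi> - \<phi>) + norm (\<psi> - \<phi>)"
      by (metis U V \<phi>S(2) norm_unitary_group norm_triangle_ineq4)
    then show False
      using \<phi>(2) by simp
  qed
  have "U t x = V t x" for t x
    using on_S[of x t] PiE_arb[OF unitary_group_ofD(1)[OF U]] PiE_arb[OF unitary_group_ofD(1)[OF V]]
    by (cases "x \<in> S") simp_all
  then show ?thesis
    by blast
qed

theorem stone: "unitary_group_of H (\<lambda>t. exp_i t H)"
proof -
  have "\<exists>!U. unitary_group_of H U"
    using unitary_group_of_group unitary_group_of_unique by blast
  then show ?thesis
    unfolding exp_i_def by (rule theI')
qed

lemmas exp_i_in = unitary_group_of_in[OF stone]
lemmas exp_i_scaleC = unitary_group_ofD(3)[OF stone]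
lemmas exp_i_has_derivative_iff = unitary_group_ofD(7)[OF stone]

end

section \<open>The observable on larger Hilbert spaces\<close>

locale bounded_observable =
  fixes Sstar :: "'a::complex_hilbert set" and A :: "'a operator"
  assumes hilbert: "hilbert_subspace Sstar"
    and bounded: "bounded_operator_on Sstar A"
    and self_adjoint: "self_adjoint_on Sstar A"
begin

text \<open>
  The extension of the observable by zero to the ambient space. Its restrictions are the extensions to all the
  Hilbert spaces of the class, which is why one symmetric operator serves for comparing ground states in different spaces.
\<close>

definition obs :: "'a \<Rightarrow> 'a" where
  "obs x = the (A (orth_proj Sstar x))"

lemma dom_A: "dom A = Sstar"
  using bounded by (simp add: bounded_operator_on_def)

lemma A_proj: "orth_proj Sstar x \<in> dom A"
  by (simp add: dom_A orth_proj_in[OF hilbert])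

lemma obs_bounded: obtains k where "0 \<le> k" "\<And>x. norm (obs x) \<le> k * norm x"
proof -
  obtain k where k: "\<And>x. x \<in> Sstar \<Longrightarrow> norm (the (A x)) \<le> k * norm x"
    using bounded by (auto simp: bounded_operator_on_def)
  have "norm (obs x) \<le> \<bar>k\<bar> * norm x" for x
  proof -
    have "norm (obs x) \<le> k * norm (orth_proj Sstar x)"
      unfolding obs_def by (rule k[OF orth_proj_in[OF hilbert]])
    also have "\<dots> \<le> \<bar>k\<bar> * norm x"
      by (intro mult_mono norm_orth_proj_le hilbert) auto
    finally show ?thesis .
  qed
  then show thesis
    using that[of "\<bar>k\<bar>"] by simp
qed

lemma obs_form_ge:
  assumes "\<And>x. norm (obs x) \<le> k * norm x"
  shows "- k * (norm x)\<^sup>2 \<le> inner x (obs x)"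
proof -
  have "norm x * norm (obs x) \<le> norm x * (k * norm x)"
    using assms by (intro mult_left_mono) auto
  then show ?thesis
    using Cauchy_Schwarz_ineq2[of x "obs x"] by (simp add: power2_eq_square mult_ac abs_le_iff)
qed

lemma obs_in: "obs x \<in> Sstar"
  using bounded A_proj[of x] unfolding obs_def bounded_operator_on_def
  by (metis domD option.sel ranI subsetD)

lemma obs_add: "obs (x + y) = obs x + obs y"
  using bounded A_proj
  by (simp add: obs_def orth_proj_add[OF hilbert] bounded_operator_on_def linear_operator_def)

lemma obs_scaleC: "obs (k *\<^sub>C x) = k *\<^sub>C obs x"
  using bounded A_proj
  by (simp add: obs_def orth_proj_scaleC[OF hilbert] bounded_operator_on_def linear_operator_def)

lemma obs_symmetric: "cinner x (obs y) = cinner (obs x) y"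
proof -
  obtain k where k: "\<And>x. norm (obs x) \<le> k * norm x"
    using obs_bounded by blast
  interpret A: semibounded_selfadjoint Sstar A "- k"
  proof
    show "- k * (norm x)\<^sup>2 \<le> inner x (the (A x))" if "x \<in> dom A" for x
      using obs_form_ge[OF k, of x] that by (simp add: obs_def dom_A orth_proj_ident[OF hilbert])
  qed (rule self_adjoint)
  have "cinner x (obs y) = cinner (orth_proj Sstar x) (obs y)"
    by (simp add: cinner_orth_proj_left[OF hilbert obs_in])
  also have "\<dots> = cinner (obs x) (orth_proj Sstar y)"
    unfolding obs_def by (rule A.symmetric[OF A_proj A_proj])
  also have "\<dots> = cinner (obs x) y"
    by (simp add: cinner_orth_proj_right[OF hilbert obs_in])
  finally show ?thesis .
qed

lemma extend_by_zero_eq: "extend_by_zero Sstar A S = (\<lambda>x. if x \<in> S then Some (obs x) else None)"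
  using A_proj by (auto simp: extend_by_zero_def obs_def fun_eq_iff domIff)

text \<open>
  Places the extended observable within the scope of Stone's theorem.
\<close>

lemma extension_semibounded_selfadjoint:
  assumes S: "S \<in> hilbert_spaces_over Sstar"
  obtains k where "semibounded_selfadjoint S (extend_by_zero Sstar A S) k"
proof -
  obtain k where k: "\<And>x. norm (obs x) \<le> k * norm x"
    using obs_bounded by blast
  have hS: "hilbert_subspace S" and sub: "Sstar \<subseteq> S"
    using S by (auto simp: hilbert_spaces_over_def)
  have cS: "complex_vector.subspace S" "closed S"
    using hS by (auto simp: hilbert_subspace_def)
  let ?B = "extend_by_zero Sstar A S"
  have dom: "dom ?B = S"
    by (auto simp: extend_by_zero_eq split: if_splits)
  have B: "the (?B x) = obs x" if "x \<in> S" for x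
    using that by (simp add: extend_by_zero_eq)
  have "adjoint_in S ?B = ?B"
  proof
    fix \<phi>
    show "adjoint_in S ?B \<phi> = ?B \<phi>"
    proof (cases "\<phi> \<in> S")
      case True
      have ex: "obs \<phi> \<in> S \<and> (\<forall>\<psi>\<in>dom ?B. cinner \<phi> (the (?B \<psi>)) = cinner (obs \<phi>) \<psi>)"
        using obs_in sub by (auto simp: dom B obs_symmetric)
      have "(THE \<zeta>. \<zeta> \<in> S \<and> (\<forall>\<psi>\<in>dom ?B. cinner \<phi> (the (?B \<psi>)) = cinner \<zeta> \<psi>)) = obs \<phi>"
      proof (rule the_equality, rule ex)
        fix \<zeta>
        assume \<zeta>: "\<zeta> \<in> S \<and> (\<forall>\<psi>\<in>dom ?B. cinner \<phi> (the (?B \<psi>)) = cinner \<zeta> \<psi>)"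
        have "\<zeta> - obs \<phi> \<in> S"
          using \<zeta> ex cS(1) by (simp add: complex_vector.subspace_diff)
        then have "cinner (\<zeta> - obs \<phi>) (\<zeta> - obs \<phi>) = 0"
          using \<zeta> ex unfolding dom cinner_diff_left by (metis cancel_comm_monoid_add_class.diff_cancel)
        then show "\<zeta> = obs \<phi>"
          by (simp add: cinner_self_eq_0)
      qed
      moreover have "adjoint_in S ?B \<phi>
          = Some (THE \<zeta>. \<zeta> \<in> S \<and> (\<forall>\<psi>\<in>dom ?B. cinner \<phi> (the (?B \<psi>)) = cinner \<zeta> \<psi>))"
        unfolding adjoint_in_def using True ex by (intro if_P) blast
      ultimately show ?thesis
        using True by (simp add: extend_by_zero_eq)
    next
      case False
      then show ?thesis
        by (simp add: adjoint_in_def extend_by_zero_eq)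
    qed
  qed
  moreover have "linear_operator ?B"
    unfolding linear_operator_def dom
    using cS(1) by (simp add: B obs_add obs_scaleC complex_vector.subspace_add complex_vector.subspace_scale)
  moreover have "ran ?B \<subseteq> S"
    using obs_in sub by (auto simp: ran_def extend_by_zero_eq split: if_splits)
  ultimately have "self_adjoint_on S ?B"
    using hS cS(2) by (simp add: self_adjoint_on_def dom)
  then have "semibounded_selfadjoint S ?B (- k)"
    by unfold_locales (use obs_form_ge[OF k] in \<open>auto simp: dom B\<close>)
  then show thesis
    by (rule that)
qed

text \<open>
  Because \<open>exp (\<i> s O)\<close> commutes with \<open>exp (\<i> t H)\<close>, it commutes with the derivative at \<open>t = 0\<close> and maps the
  eigenspace of \<open>H\<close> into itself. The eigenspace is closed, so the derivative \<open>\<i> O \<psi>\<close> of \<open>exp (\<i> s O) \<psi>\<close> at \<open>s = 0\<close> lies in it;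
  as it is one-dimensional, \<open>O \<psi>\<close> is a multiple of \<open>\<psi>\<close>.
\<close>

lemma eigenvector_of_obs:
  assumes H: "semibounded_selfadjoint S H c" and S: "S \<in> hilbert_spaces_over Sstar"
    and comm: "strongly_commute (extend_by_zero Sstar A S) H"
    and eig: "eigenspace H (complex_of_real E) = range (\<lambda>k. k *\<^sub>C \<psi>)"
  obtains m where "obs \<psi> = m *\<^sub>C \<psi>"
proof -
  let ?B = "extend_by_zero Sstar A S"
  interpret H: semibounded_selfadjoint S H c by (rule H)
  obtain b where "semibounded_selfadjoint S ?B b"
    using extension_semibounded_selfadjoint[OF S] .
  then interpret B: semibounded_selfadjoint S ?B b .
  let ?V = "eigenspace H (complex_of_real E)"
  have \<psi>V: "\<psi> \<in> ?V"
    unfolding eig by (rule image_eqI[of _ _ 1]) auto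
  then have \<psi>: "\<psi> \<in> dom H" "the (H \<psi>) = E *\<^sub>R \<psi>"
    by (auto simp: eigenspace_def scaleC_complex_of_real)
  have \<psi>S: "\<psi> \<in> S"
    using \<psi>(1) H.dom_subset by blast
  have V: "exp_i s ?B \<psi> \<in> ?V" for s
  proof -
    let ?\<phi> = "exp_i s ?B \<psi>"
    have \<phi>S: "?\<phi> \<in> S"
      by (rule B.exp_i_in[OF \<psi>S])
    have "((\<lambda>t. exp_i t H \<psi>) has_vector_derivative \<i> *\<^sub>C E *\<^sub>R \<psi>) (at 0)"
      using H.exp_i_has_derivative_iff[OF \<psi>S, of "E *\<^sub>R \<psi>"] \<psi> by auto
    from bounded_linear.has_vector_derivative[OF B.bounded_linear_unitary_group[OF B.stone] this, of s]
    have "((\<lambda>t. exp_i s ?B (exp_i t H \<psi>)) has_vector_derivative exp_i s ?B (orth_proj S (\<i> *\<^sub>C E *\<^sub>R \<psi>))) (at 0)"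
      by (simp add: orth_proj_ident[OF H.hilbert] H.exp_i_in[OF \<psi>S])
    moreover have "exp_i s ?B (exp_i t H \<psi>) = exp_i t H ?\<phi>" for t
      using comm \<psi>S by (simp add: strongly_commute_def H.hspace_eq)
    moreover have "exp_i s ?B (orth_proj S (\<i> *\<^sub>C E *\<^sub>R \<psi>)) = \<i> *\<^sub>C E *\<^sub>R ?\<phi>"
    proof -
      have "\<i> *\<^sub>C E *\<^sub>R \<psi> = (\<i> * of_real E) *\<^sub>C \<psi>" "\<i> *\<^sub>C E *\<^sub>R ?\<phi> = (\<i> * of_real E) *\<^sub>C ?\<phi>"
        by (simp_all flip: scaleC_complex_of_real add: scaleC_scaleC)
      moreover have "(\<i> * of_real E) *\<^sub>C \<psi> \<in> S"
        using \<psi>S H.csubspace by (simp add: complex_vector.subspace_scale)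
      ultimately show ?thesis
        by (simp add: orth_proj_ident[OF H.hilbert] B.exp_i_scaleC[OF \<psi>S])
    qed
    ultimately have "H ?\<phi> = Some (E *\<^sub>R ?\<phi>)"
      using H.exp_i_has_derivative_iff[OF \<phi>S] by simp
    then show ?thesis
      by (auto simp: eigenspace_def scaleC_complex_of_real)
  qed
  have "closed ?V"
    unfolding closed_sequential_limits
  proof (intro allI impI, elim conjE)
    fix u l
    assume u: "\<forall>n. u n \<in> ?V" and l: "u \<longlonglongrightarrow> l"
    have "(\<lambda>n. E *\<^sub>R u n) \<longlonglongrightarrow> E *\<^sub>R l"
      by (intro tendsto_intros l)
    then have "H l = Some (E *\<^sub>R l)"
      using u by (intro H.h_closed[OF _ l]) (auto simp: eigenspace_def scaleC_complex_of_real)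
    then show "l \<in> ?V"
      by (auto simp: eigenspace_def scaleC_complex_of_real)
  qed
  moreover have "subspace ?V"
    unfolding eig
  proof (rule csubspace_imp_subspace, rule complex_vector.subspaceI)
    show "0 \<in> range (\<lambda>k. k *\<^sub>C \<psi>)"
      by (rule image_eqI[of _ _ 0]) auto
    show "x + y \<in> range (\<lambda>k. k *\<^sub>C \<psi>)" if "x \<in> range (\<lambda>k. k *\<^sub>C \<psi>)" "y \<in> range (\<lambda>k. k *\<^sub>C \<psi>)" for x y
      using that by (auto simp flip: scaleC_add_left)
    show "k *\<^sub>C x \<in> range (\<lambda>k. k *\<^sub>C \<psi>)" if "x \<in> range (\<lambda>k. k *\<^sub>C \<psi>)" for k x
      using that by (auto simp: scaleC_scaleC)
  qed
  moreover have der: "((\<lambda>s. exp_i s ?B \<psi>) has_vector_derivative \<i> *\<^sub>C obs \<psi>) (at 0)"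
    using B.exp_i_has_derivative_iff[OF \<psi>S, of "obs \<psi>"] \<psi>S by (simp add: extend_by_zero_eq)
  ultimately have "\<i> *\<^sub>C obs \<psi> \<in> ?V"
    using derivative_in_closed_subspace[OF _ _ V der] by blast
  then obtain k where "\<i> *\<^sub>C obs \<psi> = k *\<^sub>C \<psi>"
    unfolding eig by blast
  then have "(- \<i>) *\<^sub>C \<i> *\<^sub>C obs \<psi> = (- \<i>) *\<^sub>C k *\<^sub>C \<psi>"
    by (rule arg_cong)
  then have "obs \<psi> = (- \<i> * k) *\<^sub>C \<psi>"
    by (simp only: scaleC_scaleC) simp
  then show thesis
    by (rule that)
qed

section \<open>The good quantum number\<close>

lemma P_zero_comm_hspace:
  assumes "H \<in> P_zero_comm Sstar A"
  shows "hspace H \<in> hilbert_spaces_over Sstar"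
    and "strongly_commute (extend_by_zero Sstar A (hspace H)) H"
  using assms
  by (auto simp: P_zero_comm_def P_zero_def A_plus_def self_adjoint_on_def hspace_def)

text \<open>
  The vector chosen in \<^const>\<open>ground_state\<close> may be strictly positive for a cone other than \<open>P\<close>. Simplicity
  of \<open>E(H)\<close> makes it a multiple of the ground state that is strictly positive for \<open>P\<close>, so both define the same eigenvalue. This matters
  in chains, where one operator may carry different cones towards its predecessor and its successor.
\<close>

lemma quantum_number_eigenvalue:
  assumes H: "H \<in> P_zero_comm Sstar A" and P: "self_dual_cone (hspace H) P"
    and HP: "H \<in> A_plus (hspace H) P"
  obtains \<psi> where "strictly_positive P \<psi>" "\<psi> \<noteq> 0"
    "obs \<psi> = quantum_number Sstar A H *\<^sub>C \<psi>"
proof -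
  let ?S = "hspace H" and ?E = "ground_energy H"
  note S = P_zero_comm_hspace[OF H]
  have hS: "hilbert_subspace ?S"
    using S by (simp add: hilbert_spaces_over_def)
  obtain \<psi> where \<psi>: "strictly_positive P \<psi>" "\<psi> \<noteq> 0"
    "eigenspace H (complex_of_real ?E) = range (\<lambda>k. k *\<^sub>C \<psi>)"
    using strictly_positive_ground_state[OF hS P HP] by blast
  have sa: "semibounded_selfadjoint ?S H ?E"
    using HP by (intro ground_energy_attained) (auto simp: A_plus_def)
  obtain m where m: "obs \<psi> = m *\<^sub>C \<psi>"
    using eigenvector_of_obs[OF sa S \<psi>(3)] .
  define g where "g = ground_state H"
  have "\<psi> \<in> eigenspace H (complex_of_real ?E)"
    unfolding \<psi>(3) by (rule image_eqI[of _ _ 1]) auto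
  then have "\<psi> \<noteq> 0 \<and> \<psi> \<in> eigenspace H (complex_of_real ?E) \<and>
      (\<exists>P. self_dual_cone ?S P \<and> H \<in> A_plus ?S P \<and> strictly_positive P \<psi>)"
    using P HP \<psi> by blast
  then have "g \<noteq> 0 \<and> g \<in> eigenspace H (complex_of_real ?E) \<and>
      (\<exists>P. self_dual_cone ?S P \<and> H \<in> A_plus ?S P \<and> strictly_positive P g)"
    unfolding g_def ground_state_def by (rule someI)
  then obtain k where k: "g \<noteq> 0" "g = k *\<^sub>C \<psi>"
    using \<psi>(3) by blast
  have P_S: "P \<subseteq> ?S"
    using P by (simp add: self_dual_cone_def convex_cone_in_def)
  then have \<psi>S: "\<psi> \<in> ?S"
    using \<psi>(1) by (auto simp: strictly_positive_def)
  then have "g \<in> ?S"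
    using k hS by (simp add: hilbert_subspace_def complex_vector.subspace_scale)
  then have eq: "the (extend_by_zero Sstar A ?S g) = m *\<^sub>C g"
    by (simp add: extend_by_zero_eq k(2) obs_scaleC m scaleC_scaleC mult.commute)
  have "quantum_number Sstar A H = m"
    unfolding quantum_number_def g_def[symmetric] eq
    using k(1) by (intro the_equality) auto
  then show thesis
    using that[OF \<psi>(1,2)] m by simp
qed

text \<open>
  The heart of the theorem: \<open>\<phi> \<in> P \<subseteq> Q\<close> overlaps with the strictly positive \<open>\<psi>\<close>, and symmetry of the observable
  first makes the eigenvalue of \<open>\<phi>\<close> real and then equates it with that of \<open>\<psi>\<close>.
\<close>

lemma quantum_number_inherited:
  assumes H: "H \<in> P_zero_comm Sstar A" and K: "K \<in> P_zero_comm Sstar A"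
    and inh: "inherits (H, P) (K, Q)"
  shows "quantum_number Sstar A H = quantum_number Sstar A K"
proof -
  have HP: "H \<in> A_plus (hspace H) P" and KQ: "K \<in> A_plus (hspace K) Q"
    and P: "self_dual_cone (hspace H) P" and Q: "self_dual_cone (hspace K) Q"
    and PQ: "P = orth_proj (hspace H) ` Q" "orth_proj (hspace H) ` Q \<subseteq> Q"
    using inh unfolding inherits_def cone_inherits_def positivity_preserving_def case_prod_conv
    by blast+
  let ?m = "quantum_number Sstar A H" and ?n = "quantum_number Sstar A K"
  obtain \<phi> where \<phi>: "strictly_positive P \<phi>" "\<phi> \<noteq> 0" "obs \<phi> = ?m *\<^sub>C \<phi>"
    using quantum_number_eigenvalue[OF H P HP] .
  obtain \<psi> where \<psi>: "strictly_positive Q \<psi>" "\<psi> \<noteq> 0" "obs \<psi> = ?n *\<^sub>C \<psi>"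
    using quantum_number_eigenvalue[OF K Q KQ] .
  have "\<phi> \<in> Q"
    using \<phi>(1) PQ by (auto simp: strictly_positive_def)
  then have "cinner \<phi> \<psi> \<noteq> 0"
    using \<psi>(1) \<phi>(2) unfolding strictly_positive_def by (metis DiffI less_irrefl singletonD)
  moreover have "cnj ?m * cinner \<phi> \<psi> = ?n * cinner \<phi> \<psi>"
    using obs_symmetric[of \<phi> \<psi>]
    unfolding \<phi>(3) \<psi>(3) cinner_scaleC_left cinner_scaleC_right by (rule sym)
  moreover have "cnj ?m * cinner \<phi> \<phi> = ?m * cinner \<phi> \<phi>"
    using obs_symmetric[of \<phi> \<phi>]
    unfolding \<phi>(3) cinner_scaleC_left cinner_scaleC_right by (rule sym)
  then have "cnj ?m = ?m"
    using \<phi>(2) by (simp add: cinner_self_eq_0)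
  ultimately show ?thesis
    by simp
qed

lemma quantum_number_leads_to:
  assumes "leads_to Sstar A H K"
  shows "quantum_number Sstar A H = quantum_number Sstar A K"
proof -
  obtain N :: nat and Hs P P' where N: "N \<ge> 2" "Hs 1 = H" "Hs N = K"
    and Hs: "\<forall>j\<in>{1..N}. Hs j \<in> P_zero_comm Sstar A"
    and inh: "\<forall>j\<in>{1..N - 1}. inherits (Hs j, P j) (Hs (j + 1), P' (j + 1))"
    using assms unfolding leads_to_def by (elim conjE exE) blast
  have "quantum_number Sstar A (Hs 1) = quantum_number Sstar A (Hs j)" if "1 \<le> j" "j \<le> N" for j
    using that
  proof (induction j rule: dec_induct)
    case (step j)
    have "quantum_number Sstar A (Hs j) = quantum_number Sstar A (Hs (j + 1))"
      using step inh Hs by (intro quantum_number_inherited[of _ _ "P j" "P' (j + 1)"]) auto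
    then show ?case
      using step by simp
  qed simp
  then show ?thesis
    using N by (metis le_trans one_le_numeral order_refl)
qed

end

theorem theorem3p3:
  fixes Sstar :: "'a::complex_hilbert set"
    and A :: "'a operator"
    and Cstar C :: "'a operator set"
    and Hstar H :: "'a operator"
  assumes "hilbert_subspace Sstar"
    and "bounded_operator_on Sstar A"
    and "self_adjoint_on Sstar A"
    and "purely_discrete_spec A"
    and "Cstar \<in> P_class Sstar A"
    and "Hstar \<in> Cstar"
    and "C \<in> stability_class Sstar A Cstar"
    and "H \<in> C"
  shows "quantum_number Sstar A H = quantum_number Sstar A Hstar"
proof -
  interpret bounded_observable Sstar A
    by unfold_locales (use assms in auto)
  have const: "quantum_number Sstar A X = quantum_number Sstar A Y"
    if D: "D \<in> P_class Sstar A" and XY: "X \<in> D" "Y \<in> D" for D X Y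
  proof -
    obtain Z where "D = equiv_rel Sstar A `` {Z}"
      using D unfolding P_class_def by (rule quotientE)
    then have "leads_to Sstar A Z X" "leads_to Sstar A Z Y"
      using XY by (auto simp: equiv_rel_def)
    then show ?thesis
      using quantum_number_leads_to by metis
  qed
  obtain X Y where XY: "X \<in> Cstar" "Y \<in> C" "leads_to Sstar A X Y" and C: "C \<in> P_class Sstar A"
    using assms(7) by (auto simp: stability_class_def class_leads_to_def)
  have "quantum_number Sstar A H = quantum_number Sstar A Y"
    by (rule const[OF C assms(8) XY(2)])
  also have "\<dots> = quantum_number Sstar A X"
    using quantum_number_leads_to[OF XY(3)] by simp
  also have "\<dots> = quantum_number Sstar A Hstar"
    by (rule const[OF assms(5) XY(1) assms(6)])
  finally show ?thesis .
qed

end
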